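(* Let $\{\phi_1,\ldots,\phi_n\}$ be a collection of $\pi$-lifts of Frobenius on $A_\pi$ and let $r\ge 0$. Then every arithmetic partial differential operator $f\colon A_\pi\to A_\pi$ of order at most $r$ is analytic of level $r$. Moreover, if $\phi_1=\mathrm{id}$, then the converse holds: every function $f\colon A_\pi\to A_\pi$ that is analytic of level $r$ is an arithmetic partial differential operator of order at most $r$.
   Context: Fix a prime $p$. Let $\pi$ be a root, in a fixed algebraic closure of $\mathbf{Q}_p$, of an Eisenstein polynomial with coefficients in $\mathbf{Z}_p$ such that $\mathbf{Q}_p(\pi)/\mathbf{Q}_p$ is Galois, and let $A_\pi=\mathbf{Z}_p[\pi]$ be the ring of integers of $\mathbf{Q}_p(\pi)$ (its residue field is $\mathbf{F}_p$). A $\pi$-lift of Frobenius on $A_\pi$ is a ring homomorphism $\phi\colon A_\pi\to A_\pi$ with $\phi(a)\equiv a^p \bmod \pi$ for all $a\in A_\pi$. Here these arise as restrictions to $A_\pi$ of Frobenius automorphisms, i.e. of continuous elements of $\mathrm{Gal}(K^{\mathrm{alg}}/\mathbf{Q}_p)$ inducing the $p$-power Frobenius on the residue field of $K^{\mathrm{alg}}$, where $K$ is the completion of the maximal unramified extension of $\mathbf{Q}_p$. To $\phi_i$ one associates the $\pi$-derivation $\delta_i\colon A_\pi\to A_\pi$, $\delta_i(a)=(\phi_i(a)-a^p)/\pi$. $\mathbb{M}$ denotes the free non-commutative monoid of words on $\{1,\ldots,n\}$ under concatenation (with the empty word, denoted $0$, of length $0$), and $\mathbb{M}^r$ the set of words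 of length at most $r$. For $\mu=i_1\cdots i_s$ put $\phi_\mu=\phi_{i_1}\circ\cdots\circ\phi_{i_s}$ and $\delta_\mu=\delta_{i_1}\circ\cdots\circ\delta_{i_s}$ (both are the identity for the empty word). A restricted power series over $A_\pi$ is a formal power series with coefficients in $A_\pi$ tending to $0$ $\pi$-adically. Let $\Gamma$ be the ring of restricted power series over $A_\pi$ in the variables $x_\mu$, $\mu\in\mathbb{M}^r$. A function $f\colon A_\pi\to A_\pi$ is an arithmetic partial differential operator of order at most $r$ if there is $G\in\Gamma$ such that $f(v)=G(\delta_\mu(v):\mu\in\mathbb{M}^r)$ for all $v\in A_\pi$. A function $f\colon A_\pi\to A_\pi$ is analytic of level $r$ if for every $a\in A_\pi$ there is $F_a\in\Gamma$ such that $f(a+\pi^r u)=F_a(\phi_\mu(u):\mu\in\mathbb{M}^r)$ for all $u\in A_\pi$. *)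

theory Defs
  imports
    "HOL-Algebra.Algebraic_Closure_Type"
    "HOL-Library.Poly_Mapping"
    "Berlekamp_Zassenhaus.Finite_Field"
begin

text \<open>
  The prime \<open>p\<close> is \<open>CARD('p)\<close> for a type \<open>'p\<close> of class \<open>prime_card\<close>, so that the p-adic
  integers, their fraction field, and its algebraic closure are types.
  The p-adic integers are the inverse limit of the rings of integers modulo \<open>p^n\<close>:
  \<open>x n\<close> is the representative of the \<open>n\<close>-th component in \<open>{0..<p^n}\<close>.
\<close>

typedef 'p padic_int =
  "{x :: nat \<Rightarrow> int. \<forall>n. x n = x (Suc n) mod int CARD('p::prime_card) ^ n}"
  by (rule exI[of _ "\<lambda>_. 0"]) simp

setup_lifting type_definition_padic_int

lemma Rep_padic_int_Suc:
  "Rep_padic_int (x :: 'p::prime_card padic_int) n = Rep_padic_int x (Suc n) mod int CARD('p) ^ n"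
  using Rep_padic_int[of x] by blast

lemma Rep_padic_int_mod_self:
  "Rep_padic_int (x :: 'p::prime_card padic_int) n mod int CARD('p) ^ n = Rep_padic_int x n"
  by (subst (1 2) Rep_padic_int_Suc) (rule mod_mod_trivial)

lemma mod_power_Suc_mod:
  "(a :: int) mod (c ^ Suc n) mod (c ^ n) = a mod c ^ n"
  by (rule mod_mod_cancel) simp

lemma padic_coherentI:
  fixes h :: "nat \<Rightarrow> int" and p :: int
  assumes "\<And>n. h (Suc n) mod p ^ n = h n mod p ^ n"
  shows "h n mod p ^ n = (h (Suc n) mod p ^ Suc n) mod p ^ n"
  using assms by (simp only: mod_power_Suc_mod)

lemma padic_coherentD:
  fixes x :: "nat \<Rightarrow> int" and p :: int
  assumes "\<And>n. x n = x (Suc n) mod p ^ n"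
  shows "x (Suc n) mod p ^ n = x n mod p ^ n"
  by (subst (2) assms) (rule mod_mod_trivial [symmetric])

instantiation padic_int :: (prime_card) comm_ring_1
begin

lift_definition zero_padic_int :: "'a padic_int" is "\<lambda>_. 0"
  by simp

lift_definition one_padic_int :: "'a padic_int"
  is "\<lambda>n. 1 mod int CARD('a) ^ n"
  by (intro allI padic_coherentI) simp

lift_definition plus_padic_int :: "'a padic_int \<Rightarrow> 'a padic_int \<Rightarrow> 'a padic_int"
  is "\<lambda>x y n. (x n + y n) mod int CARD('a) ^ n"
  by (intro allI padic_coherentI) (intro mod_add_cong padic_coherentD; assumption)

lift_definition minus_padic_int :: "'a padic_int \<Rightarrow> 'a padic_int \<Rightarrow> 'a padic_int"
  is "\<lambda>x y n. (x n - y n) mod int CARD('a) ^ n"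
  by (intro allI padic_coherentI) (intro mod_diff_cong padic_coherentD; assumption)

lift_definition uminus_padic_int :: "'a padic_int \<Rightarrow> 'a padic_int"
  is "\<lambda>x n. (- x n) mod int CARD('a) ^ n"
  by (intro allI padic_coherentI) (intro mod_minus_cong padic_coherentD; assumption)

lift_definition times_padic_int :: "'a padic_int \<Rightarrow> 'a padic_int \<Rightarrow> 'a padic_int"
  is "\<lambda>x y n. (x n * y n) mod int CARD('a) ^ n"
  by (intro allI padic_coherentI) (intro mod_mult_cong padic_coherentD; assumption)

instance
proof
  have eqI: "x = y" if "\<And>n. Rep_padic_int x n = Rep_padic_int y n" for x y :: "'a padic_int"
    using that by (simp add: fun_eq_iff flip: Rep_padic_int_inject)
  note reps = zero_padic_int.rep_eq one_padic_int.rep_eq plus_padic_int.rep_eq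
    minus_padic_int.rep_eq uminus_padic_int.rep_eq times_padic_int.rep_eq Rep_padic_int_mod_self
  fix a b c :: "'a padic_int"
  show "a * b * c = a * (b * c)"
    by (rule eqI) (simp add: reps mod_simps mult.assoc)
  show "a * b = b * a"
    by (rule eqI) (simp add: reps mult.commute)
  show "1 * a = a"
    by (rule eqI) (simp add: reps mod_simps)
  show "a + b + c = a + (b + c)"
    by (rule eqI) (simp add: reps mod_simps add.assoc)
  show "a + b = b + a"
    by (rule eqI) (simp add: reps add.commute)
  show "0 + a = a"
    by (rule eqI) (simp add: reps)
  show "- a + a = 0"
    by (rule eqI) (simp add: reps mod_simps)
  show "a - b = a + - b"
    by (rule eqI) (simp add: reps mod_simps)
  show "(a + b) * c = a * c + b * c"
    by (rule eqI) (simp add: reps mod_simps ring_distribs)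
  show "(0 :: 'a padic_int) \<noteq> 1"
  proof
    assume "(0 :: 'a padic_int) = 1"
    then have "Rep_padic_int (0 :: 'a padic_int) 1 = Rep_padic_int (1 :: 'a padic_int) 1"
      by simp
    then have "0 = 1 mod int CARD('a) ^ 1"
      by (simp only: zero_padic_int.rep_eq one_padic_int.rep_eq)
    moreover have "1 < int CARD('a)"
      using prime_card[where 'a='a] prime_gt_1_nat by auto
    ultimately show False by simp
  qed
qed

end

lemma Rep_padic_int_mod:
  assumes "m \<le> n"
  shows "Rep_padic_int (x :: 'p::prime_card padic_int) n mod int CARD('p) ^ m = Rep_padic_int x m"
  using assms
proof (induction rule: dec_induct)
  case base
  show ?case by (rule Rep_padic_int_mod_self)
next
  case (step n)
  let ?p = "int CARD('p)"
  have "?p ^ m dvd ?p ^ n"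
    using step.hyps by (simp add: le_imp_power_dvd)
  then have "Rep_padic_int x (Suc n) mod ?p ^ m = Rep_padic_int x n mod ?p ^ m"
    by (subst Rep_padic_int_Suc[of x n]) (simp add: mod_mod_cancel)
  then show ?case using step.IH by (rule trans)
qed

lemma prime_elem_mult_power_dvd:
  fixes p a b :: int
  assumes "prime p" "p ^ (k + l) dvd a * b"
  shows "p ^ k dvd a \<or> p ^ l dvd b"
proof (cases "a = 0 \<or> b = 0")
  case False
  then have "k + l \<le> multiplicity p a + multiplicity p b"
    using assms(2) multiplicity_geI[of "a * b" p "k + l"] prime_gt_1_int[OF assms(1)]
      prime_elem_multiplicity_mult_distrib[OF prime_imp_prime_elem[OF assms(1)], of a b]
    by auto
  then have "k \<le> multiplicity p a \<or> l \<le> multiplicity p b"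
    by linarith
  then show ?thesis
    by (auto intro: multiplicity_dvd')
qed auto

instance padic_int :: (prime_card) idom
proof
  fix a b :: "'a padic_int"
  assume "a \<noteq> 0" "b \<noteq> 0"
  let ?p = "int CARD('a)"
  have ex: "\<exists>n. Rep_padic_int x n \<noteq> 0" if "x \<noteq> 0" for x :: "'a padic_int"
    using that by (auto simp: fun_eq_iff zero_padic_int.rep_eq simp flip: Rep_padic_int_inject)
  obtain k l where k: "Rep_padic_int a k \<noteq> 0" and l: "Rep_padic_int b l \<noteq> 0"
    using ex \<open>a \<noteq> 0\<close> \<open>b \<noteq> 0\<close> by metis
  have "\<not> ?p ^ k dvd Rep_padic_int a (k + l)" "\<not> ?p ^ l dvd Rep_padic_int b (k + l)"
    using k l Rep_padic_int_mod[of k "k + l" a] Rep_padic_int_mod[of l "k + l" b]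
    by (auto simp: dvd_eq_mod_eq_0)
  then have "\<not> ?p ^ (k + l) dvd Rep_padic_int a (k + l) * Rep_padic_int b (k + l)"
    using prime_elem_mult_power_dvd[OF prime_card_int] by blast
  then have "Rep_padic_int (a * b) (k + l) \<noteq> 0"
    by (simp add: times_padic_int.rep_eq dvd_eq_mod_eq_0)
  then show "a * b \<noteq> 0"
    by (auto simp: zero_padic_int.rep_eq)
qed

type_synonym 'p Qp_closure = "'p padic_int fract alg_closure"

definition of_padic_int :: "'p::prime_card padic_int \<Rightarrow> 'p Qp_closure" where
  "of_padic_int x = to_ac (to_fract x)"

text \<open>The leading coefficient is only required to be a unit; the roots are those of the monic
  Eisenstein polynomial obtained by dividing by it.\<close>

definition eisenstein :: "'p::prime_card padic_int poly \<Rightarrow> bool" where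
  "eisenstein E \<longleftrightarrow>
     Polynomial.degree E > 0 \<and>
     \<not> of_nat CARD('p) dvd Polynomial.lead_coeff E \<and>
     (\<forall>i < Polynomial.degree E. of_nat CARD('p) dvd Polynomial.coeff E i) \<and>
     \<not> (of_nat CARD('p))\<^sup>2 dvd Polynomial.coeff E 0"

text \<open>The field generated by \<open>x\<close> over the base field; a zero denominator contributes only \<open>0\<close>.\<close>

definition simple_field_extension :: "'a::field alg_closure \<Rightarrow> 'a alg_closure set" where
  "simple_field_extension x =
     {Polynomial.poly (map_poly to_ac f) x / Polynomial.poly (map_poly to_ac g) x | f g. True}"

text \<open>
  A subfield \<open>L\<close> of the algebraic closure is Galois over the base field if it is normal and
  separable: every irreducible polynomial over the base field with a root in \<open>L\<close> is a product
  of pairwise distinct linear factors over \<open>L\<close>.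
\<close>

definition galois_over_base :: "'a::field alg_closure set \<Rightarrow> bool" where
  "galois_over_base L \<longleftrightarrow>
     (\<forall>q :: 'a poly. irreducible q \<and> (\<exists>x\<in>L. Polynomial.poly (map_poly to_ac q) x = 0) \<longrightarrow>
        (\<exists>c S. finite S \<and> S \<subseteq> L \<and>
           map_poly to_ac q = Polynomial.smult c (\<Prod>x\<in>S. [:- x, 1:])))"

definition admissible_uniformizer :: "'p::prime_card Qp_closure \<Rightarrow> bool" where
  "admissible_uniformizer \<pi> \<longleftrightarrow>
     (\<exists>E :: 'p padic_int poly.
        eisenstein E \<and> Polynomial.poly (map_poly of_padic_int E) \<pi> = 0) \<and>
     galois_over_base (simple_field_extension \<pi>)"

definition Zp_adjoin :: "'p::prime_card Qp_closure \<Rightarrow> 'p Qp_closure set" where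
  "Zp_adjoin \<pi> = range (\<lambda>q :: 'p padic_int poly. Polynomial.poly (map_poly of_padic_int q) \<pi>)"

definition pi_cong ::
    "'p::prime_card Qp_closure \<Rightarrow> nat \<Rightarrow> 'p Qp_closure \<Rightarrow> 'p Qp_closure \<Rightarrow> bool" where
  "pi_cong \<pi> N a b \<longleftrightarrow> (\<exists>c \<in> Zp_adjoin \<pi>. a - b = \<pi> ^ N * c)"

definition frobenius_lift ::
    "'p::prime_card Qp_closure \<Rightarrow> ('p Qp_closure \<Rightarrow> 'p Qp_closure) \<Rightarrow> bool" where
  "frobenius_lift \<pi> \<phi> \<longleftrightarrow>
     \<phi> \<in> Zp_adjoin \<pi> \<rightarrow> Zp_adjoin \<pi> \<and> \<phi> 1 = 1 \<and>
     (\<forall>a \<in> Zp_adjoin \<pi>. \<forall>b \<in> Zp_adjoin \<pi>. \<phi> (a + b) = \<phi> a + \<phi> b \<and> \<phi> (a * b) = \<phi> a * \<phi> b) \<and>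
     (\<forall>a \<in> Zp_adjoin \<pi>. pi_cong \<pi> 1 (\<phi> a) (a ^ CARD('p)))"

definition pi_derivation ::
    "'p::prime_card Qp_closure \<Rightarrow> ('p Qp_closure \<Rightarrow> 'p Qp_closure) \<Rightarrow> 'p Qp_closure \<Rightarrow> 'p Qp_closure"
  where "pi_derivation \<pi> \<phi> a = (\<phi> a - a ^ CARD('p)) / \<pi>"

text \<open>The words on \<open>{1..n}\<close> of length at most \<open>r\<close>. In \<open>word_comp\<close> below the first letter
  of a word is the outermost map.\<close>

definition words :: "nat \<Rightarrow> nat \<Rightarrow> nat list set" where
  "words n r = {\<mu> \<in> lists {1..n}. length \<mu> \<le> r}"

primrec word_comp :: "('i \<Rightarrow> 'a \<Rightarrow> 'a) \<Rightarrow> 'i list \<Rightarrow> 'a \<Rightarrow> 'a" where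
  "word_comp h [] = id"
| "word_comp h (i # \<mu>) = h i \<circ> word_comp h \<mu>"

text \<open>
  A power series in the variables indexed by a finite set \<open>W\<close> is its family of coefficients on
  the monomials in these variables; values of the family at other exponents are irrelevant.
\<close>

definition monomials :: "'i set \<Rightarrow> ('i \<Rightarrow>\<^sub>0 nat) set" where
  "monomials W = {e. Poly_Mapping.keys e \<subseteq> W}"

definition restricted_power_series ::
    "'p::prime_card Qp_closure \<Rightarrow> 'i set \<Rightarrow> (('i \<Rightarrow>\<^sub>0 nat) \<Rightarrow> 'p Qp_closure) set" where
  "restricted_power_series \<pi> W =
     {G. (\<forall>e \<in> monomials W. G e \<in> Zp_adjoin \<pi>) \<and>
         (\<forall>N. finite {e \<in> monomials W. \<not> pi_cong \<pi> N (G e) 0})}"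

text \<open>\<open>has_value \<pi> W G x s\<close>: the series \<open>G\<close> evaluated at \<open>x\<close> converges \<open>\<pi>\<close>-adically to \<open>s\<close>.\<close>

definition has_value ::
    "'p::prime_card Qp_closure \<Rightarrow> 'i set \<Rightarrow> (('i \<Rightarrow>\<^sub>0 nat) \<Rightarrow> 'p Qp_closure) \<Rightarrow>
     ('i \<Rightarrow> 'p Qp_closure) \<Rightarrow> 'p Qp_closure \<Rightarrow> bool" where
  "has_value \<pi> W G x s \<longleftrightarrow>
     (\<forall>N. \<forall>\<^sub>F F in finite_subsets_at_top (monomials W).
        pi_cong \<pi> N (\<Sum>e\<in>F. G e * (\<Prod>i\<in>W. x i ^ Poly_Mapping.lookup e i)) s)"

definition arithmetic_pdo ::
    "'p::prime_card Qp_closure \<Rightarrow> nat \<Rightarrow> (nat \<Rightarrow> 'p Qp_closure \<Rightarrow> 'p Qp_closure) \<Rightarrow> nat \<Rightarrow>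
     ('p Qp_closure \<Rightarrow> 'p Qp_closure) \<Rightarrow> bool" where
  "arithmetic_pdo \<pi> n \<phi> r f \<longleftrightarrow>
     (\<exists>G \<in> restricted_power_series \<pi> (words n r). \<forall>v \<in> Zp_adjoin \<pi>.
        has_value \<pi> (words n r) G (\<lambda>\<mu>. word_comp (\<lambda>i. pi_derivation \<pi> (\<phi> i)) \<mu> v) (f v))"

definition analytic_of_level ::
    "'p::prime_card Qp_closure \<Rightarrow> nat \<Rightarrow> (nat \<Rightarrow> 'p Qp_closure \<Rightarrow> 'p Qp_closure) \<Rightarrow> nat \<Rightarrow>
     ('p Qp_closure \<Rightarrow> 'p Qp_closure) \<Rightarrow> bool" where
  "analytic_of_level \<pi> n \<phi> r f \<longleftrightarrow>
     (\<forall>a \<in> Zp_adjoin \<pi>. \<exists>G \<in> restricted_power_series \<pi> (words n r). \<forall>u \<in> Zp_adjoin \<pi>.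
        has_value \<pi> (words n r) G (\<lambda>\<mu>. word_comp \<phi> \<mu> u) (f (a + \<pi> ^ r * u)))"

end

theory Submission
  imports Defs
begin

text \<open>
  Let \<open>A = Zp[\<pi>]\<close>. It is a complete ring in which \<open>p\<close> is a unit times \<open>\<pi> ^ e\<close> and every element is
  congruent to an integer modulo \<open>\<pi>\<close>. A function on \<open>A\<close> is given by a restricted power series in
  coordinate functions \<open>y i\<close> exactly if it is a sum \<open>\<Sum>k. \<pi> ^ k g k\<close> of polynomials \<open>g k\<close> in the \<open>y i\<close>
  (\<open>has_value_series_funs\<close>, \<open>series_funs_has_value\<close>). Such sums form a ring closed under further
  sums of this shape, so power series need not be composed formally.

  Everything rests on one computation (\<open>\<delta>w_ball\<close>): for a word \<open>\<mu>\<close> of length at most \<open>k\<close>,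
  \<open>\<delta>\<^sub>\<mu> (a + \<pi> ^ k u) = \<delta>\<^sub>\<mu> a + \<pi> ^ (k - |\<mu>|) (c \<phi>\<^sub>\<mu> u + \<pi> Q u)\<close>, where \<open>c\<close> is a unit of \<open>A\<close> and \<open>Q\<close> is a
  polynomial in the \<open>\<phi>\<^sub>\<nu> u\<close> with \<open>|\<nu>| \<le> |\<mu>|\<close>. It follows by induction on the word from the binomial
  theorem and from the fact that a lift of Frobenius maps \<open>\<pi>\<close> to a unit multiple of itself
  (\<open>frobenius_lift_pi\<close>). Taking \<open>k = r\<close> and substituting into the series of an operator of order \<open>r\<close>
  shows that the operator is analytic of level \<open>r\<close>.

  If \<open>\<phi>\<^sub>1 = id\<close>, then \<open>\<phi>\<^sub>\<mu>\<close> does not change when \<open>\<mu>\<close> is lengthened by letters \<open>1\<close>, so every \<open>\<phi>\<^sub>\<mu>\<close> with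
  \<open>|\<mu>| \<le> r\<close> belongs to a word of length exactly \<open>r\<close>. For such words the formula solves for \<open>\<phi>\<^sub>\<mu> u\<close> in
  terms of \<open>\<delta>\<^sub>\<mu> (a + \<pi> ^ r u)\<close> up to \<open>\<pi>\<close> times a polynomial in the unknowns, and successive
  approximation (\<open>series_funs_change_of_coordinates\<close>) turns a series in the \<open>\<phi>\<^sub>\<mu> u\<close> into one in the
  \<open>\<delta>\<^sub>\<mu>\<close>. Hence an analytic function of level \<open>r\<close> agrees with an operator of order \<open>r\<close> on each ball of
  radius \<open>\<pi> ^ r\<close>. These operators are glued along the tree of balls (\<open>glue_residue_classes\<close>): the
  iterates \<open>\<delta>\<^sub>1 ^ k\<close> with \<open>k < r\<close> distinguish the balls, and the indicator of a residue class of \<open>x\<close>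
  modulo \<open>\<pi>\<close> is a restricted power series in \<open>x\<close> and \<open>\<delta>\<^sub>1 x\<close> (\<open>residue_indicator\<close>).
\<close>

section \<open>The p-adic integers\<close>

lemma padic_int_eqI:
  "(\<And>n. Rep_padic_int x n = Rep_padic_int y n) \<Longrightarrow> x = (y :: 'p::prime_card padic_int)"
  by (simp add: fun_eq_iff flip: Rep_padic_int_inject)

lemmas Rep_padic_int_arith =
  zero_padic_int.rep_eq one_padic_int.rep_eq plus_padic_int.rep_eq
  minus_padic_int.rep_eq uminus_padic_int.rep_eq times_padic_int.rep_eq

lemma Rep_padic_int_of_nat:
  "Rep_padic_int (of_nat k :: 'p::prime_card padic_int) n = int k mod int CARD('p) ^ n"
  by (induction k) (simp_all add: Rep_padic_int_arith mod_simps)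

lemma Rep_padic_int_of_nat_power:
  "Rep_padic_int ((of_nat k :: 'p::prime_card padic_int) ^ m) n = int k ^ m mod int CARD('p) ^ n"
  using Rep_padic_int_of_nat[of "k ^ m" n, where 'p='p] by simp

text \<open>The quotient by \<open>p ^ n\<close> is read off from the components shifted by \<open>n\<close>.\<close>

lemma power_p_dvd_padic_iff:
  fixes x :: "'p::prime_card padic_int"
  shows "of_nat CARD('p) ^ n dvd x \<longleftrightarrow> Rep_padic_int x n = 0"
proof
  assume "of_nat CARD('p) ^ n dvd x"
  then obtain y where "x = of_nat CARD('p) ^ n * y" by (elim dvdE)
  then show "Rep_padic_int x n = 0"
    by (simp add: Rep_padic_int_arith Rep_padic_int_of_nat_power)
next
  assume x0: "Rep_padic_int x n = 0"
  let ?p = "int CARD('p)"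
  define h where "h m = Rep_padic_int x (m + n) div ?p ^ n" for m
  have coh: "h m = h (Suc m) mod ?p ^ m" for m
  proof -
    have "Rep_padic_int x (m + n) = Rep_padic_int x (Suc m + n) mod (?p ^ n * ?p ^ m)"
      using Rep_padic_int_Suc[of x "m + n"] by (simp add: power_add mult.commute)
    then have "h m = (?p ^ n * (Rep_padic_int x (Suc m + n) div ?p ^ n mod ?p ^ m)
        + Rep_padic_int x (Suc m + n) mod ?p ^ n) div ?p ^ n"
      by (simp add: h_def zmod_zmult2_eq)
    also have "\<dots> = h (Suc m) mod ?p ^ m"
      using prime_card_int[where 'a='p] by (simp add: h_def prime_gt_0_int)
    finally show ?thesis .
  qed
  define y where "y = (Abs_padic_int h :: 'p padic_int)"
  have y: "Rep_padic_int y = h"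
    unfolding y_def by (rule Abs_padic_int_inverse) (use coh in blast)
  have "x = of_nat CARD('p) ^ n * y"
  proof (rule padic_int_eqI)
    fix m
    have "?p ^ n dvd Rep_padic_int x (m + n)"
      using Rep_padic_int_mod[of n "m + n" x] x0 by (simp add: dvd_eq_mod_eq_0)
    then have "?p ^ n * h m = Rep_padic_int x (m + n)"
      by (simp add: h_def)
    then have "Rep_padic_int (of_nat CARD('p) ^ n * y) m = Rep_padic_int x (m + n) mod ?p ^ m"
      by (simp add: Rep_padic_int_arith Rep_padic_int_of_nat_power y mod_simps)
    then show "Rep_padic_int x m = Rep_padic_int (of_nat CARD('p) ^ n * y) m"
      using Rep_padic_int_mod[of m "m + n" x] by simp
  qed
  then show "of_nat CARD('p) ^ n dvd x" by simp
qed

lemma Rep_padic_int_eq_iff_dvd: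
  fixes x y :: "'p::prime_card padic_int"
  shows "Rep_padic_int x n = Rep_padic_int y n \<longleftrightarrow> of_nat CARD('p) ^ n dvd x - y"
proof -
  have "of_nat CARD('p) ^ n dvd x - y
      \<longleftrightarrow> Rep_padic_int x n mod int CARD('p) ^ n = Rep_padic_int y n mod int CARD('p) ^ n"
    by (simp add: power_p_dvd_padic_iff minus_padic_int.rep_eq mod_eq_dvd_iff dvd_eq_mod_eq_0)
  then show ?thesis by (simp add: Rep_padic_int_mod_self)
qed

text \<open>The sum of the series has as its \<open>N\<close>-th component that of the \<open>N\<close>-th partial sum.\<close>

lemma padic_int_complete:
  fixes z :: "nat \<Rightarrow> 'p::prime_card padic_int"
  obtains s where "\<And>N. of_nat CARD('p) ^ N dvd s - (\<Sum>k<N. of_nat CARD('p) ^ k * z k)"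
proof -
  let ?p = "int CARD('p)"
  define S where "S N = (\<Sum>k<N. of_nat CARD('p) ^ k * z k)" for N
  define h where "h N = Rep_padic_int (S N) N" for N
  have coh: "h N = h (Suc N) mod ?p ^ N" for N
  proof -
    have "Rep_padic_int (S (Suc N)) N = Rep_padic_int (S N) N"
      by (simp add: Rep_padic_int_eq_iff_dvd S_def)
    then show ?thesis
      using Rep_padic_int_Suc[of "S (Suc N)" N] by (simp add: h_def)
  qed
  define s where "s = (Abs_padic_int h :: 'p padic_int)"
  have s: "Rep_padic_int s = h"
    unfolding s_def by (rule Abs_padic_int_inverse) (use coh in blast)
  have "of_nat CARD('p) ^ N dvd s - S N" for N
    by (simp add: power_p_dvd_padic_iff minus_padic_int.rep_eq s h_def)
  then show thesis using that by (auto simp: S_def)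
qed

lemma padic_int_residue:
  fixes x :: "'p::prime_card padic_int"
  obtains j where "j < CARD('p)" "of_nat CARD('p) dvd x - of_nat j"
proof
  let ?p = "int CARD('p)" and ?j = "nat (Rep_padic_int x 1)"
  have p: "0 < ?p" using prime_card[where 'a='p] by (simp add: prime_gt_0_nat)
  have j: "Rep_padic_int x 1 = Rep_padic_int x 1 mod ?p"
    using Rep_padic_int_mod_self[of x 1] by simp
  have ge: "0 \<le> Rep_padic_int x 1" and lt: "Rep_padic_int x 1 < ?p"
    using p by (subst j, simp)+
  show "?j < CARD('p)" using ge lt by linarith
  show "of_nat CARD('p) dvd x - of_nat ?j"
    using power_p_dvd_padic_iff[of 1 "x - of_nat ?j"] ge
    by (simp add: minus_padic_int.rep_eq Rep_padic_int_of_nat mod_simps)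
qed

lemma inverse_mod_prime_card:
  assumes "\<not> int CARD('p::prime_card) dvd j"
  obtains k m where "j * k = 1 + int CARD('p) * m"
proof -
  have "coprime j (int CARD('p))"
    using assms prime_imp_coprime[OF prime_card_int[where 'a='p], of j] by (simp add: coprime_commute)
  then obtain k where "[j * k = 1] (mod int CARD('p))"
    using cong_solve_coprime_int by blast
  then obtain m where "j * k - 1 = int CARD('p) * m" by (auto simp: cong_iff_dvd_diff)
  then show thesis by (intro that[of k m]) simp
qed

text \<open>An inverse modulo \<open>p\<close> is improved to an exact one by the geometric series.\<close>

lemma padic_int_unit:
  fixes d :: "'p::prime_card padic_int"
  assumes "\<not> of_nat CARD('p) dvd d"
  shows "d dvd 1"
proof -
  let ?P = "of_nat CARD('p) :: 'p padic_int"
  obtain j where j: "?P dvd d - of_nat j" by (rule padic_int_residue)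
  then have "\<not> ?P dvd of_nat j" using assms dvd_add[of ?P "d - of_nat j" "of_nat j"] by auto
  then have "\<not> int CARD('p) dvd int j"
    by (auto simp: int_dvd_int_iff elim!: dvdE)
  then obtain k m where km: "int j * k = 1 + int CARD('p) * m"
    by (rule inverse_mod_prime_card)
  obtain t0 where t0: "d = of_nat j + ?P * t0" using j by (auto simp: dvd_def algebra_simps)
  have "of_int (int j * k) = (1 + ?P * of_int m)" by (simp add: km)
  then have "d * of_int k = 1 - ?P * - (of_int m + t0 * of_int k)"
    by (simp add: t0 algebra_simps)
  then obtain t where t: "d * of_int k = 1 - ?P * t" by blast
  obtain s where s: "\<And>N. ?P ^ N dvd s - (\<Sum>i<N. ?P ^ i * t ^ i)"
    using padic_int_complete[of "\<lambda>i. t ^ i"] by blast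
  have "s * (1 - ?P * t) = 1"
  proof (rule padic_int_eqI)
    fix N
    have "(\<Sum>i<N. ?P ^ i * t ^ i) * (1 - ?P * t) = 1 - ?P ^ N * t ^ N"
      using one_diff_power_eq[of "?P * t" N] by (simp add: power_mult_distrib mult.commute)
    then have "s * (1 - ?P * t) - 1
        = (s - (\<Sum>i<N. ?P ^ i * t ^ i)) * (1 - ?P * t) - ?P ^ N * t ^ N"
      by (simp add: algebra_simps)
    then have "?P ^ N dvd s * (1 - ?P * t) - 1" using s[of N] by simp
    then show "Rep_padic_int (s * (1 - ?P * t)) N = Rep_padic_int (1 :: 'p padic_int) N"
      by (rule iffD2[OF Rep_padic_int_eq_iff_dvd])
  qed
  then have "d * (of_int k * s) = 1"
    unfolding t[symmetric] by (simp only: ac_simps)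
  then show ?thesis by (metis dvdI)
qed

lemma of_padic_int_0 [simp]: "of_padic_int 0 = 0"
  and of_padic_int_1 [simp]: "of_padic_int 1 = 1"
  and of_padic_int_add [simp]: "of_padic_int (x + y) = of_padic_int x + of_padic_int y"
  and of_padic_int_mult [simp]: "of_padic_int (x * y) = of_padic_int x * of_padic_int y"
  and of_padic_int_minus [simp]: "of_padic_int (- x) = - of_padic_int x"
  and of_padic_int_diff [simp]: "of_padic_int (x - y) = of_padic_int x - of_padic_int y"
  and of_padic_int_eq_iff [simp]: "of_padic_int x = of_padic_int y \<longleftrightarrow> x = y"
  by (simp_all add: of_padic_int_def)

lemma of_padic_int_of_nat [simp]: "of_padic_int (of_nat k) = of_nat k"
  by (induction k) simp_all

lemma of_padic_int_power [simp]: "of_padic_int (x ^ k) = of_padic_int x ^ k"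
  by (induction k) simp_all

lemma of_padic_int_sum: "of_padic_int (\<Sum>i\<in>I. f i) = (\<Sum>i\<in>I. of_padic_int (f i))"
  by (induction I rule: infinite_finite_induct) simp_all

interpretation of_padic_int: map_poly_comm_ring_hom of_padic_int
  by unfold_locales simp_all

lemma of_padic_int_eq_0_iff [simp]: "of_padic_int x = 0 \<longleftrightarrow> x = 0"
  by (metis of_padic_int_0 of_padic_int_eq_iff)

lemma map_poly_of_padic_int_pCons [simp]:
  "map_poly of_padic_int (pCons c q) = pCons (of_padic_int c) (map_poly of_padic_int q)"
  by (simp add: Polynomial.map_poly_pCons)

section \<open>The ring generated by a root of an Eisenstein polynomial\<close>

locale eisenstein_root =
  fixes \<pi> :: "'p::prime_card Qp_closure" and E :: "'p padic_int poly"
  assumes eisenstein: "eisenstein E"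
    and root: "Polynomial.poly (map_poly of_padic_int E) \<pi> = 0"
begin

abbreviation A where "A \<equiv> Zp_adjoin \<pi>"

abbreviation e where "e \<equiv> Polynomial.degree E"

abbreviation P :: "'p Qp_closure" where "P \<equiv> of_nat CARD('p)"

lemma e_pos: "0 < e"
  using eisenstein by (simp add: eisenstein_def)

lemma A_of_padic_int [simp, intro]: "of_padic_int c \<in> A"
  unfolding Zp_adjoin_def by (rule range_eqI[of _ _ "[:c:]"]) simp

lemma A_add [simp, intro]: "x \<in> A \<Longrightarrow> y \<in> A \<Longrightarrow> x + y \<in> A"
  unfolding Zp_adjoin_def image_iff by (metis UNIV_I of_padic_int.hom_add poly_add)

lemma A_mult [simp, intro]: "x \<in> A \<Longrightarrow> y \<in> A \<Longrightarrow> x * y \<in> A"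
  unfolding Zp_adjoin_def image_iff by (metis UNIV_I of_padic_int.hom_mult poly_mult)

lemma A_pi [simp, intro]: "\<pi> \<in> A"
  unfolding Zp_adjoin_def by (rule range_eqI[of _ _ "[:0, 1:]"]) simp

lemma A_of_nat [simp, intro]: "of_nat k \<in> A"
  using A_of_padic_int[of "of_nat k"] by simp

lemma A_0 [simp, intro]: "0 \<in> A" and A_1 [simp, intro]: "1 \<in> A"
  using A_of_nat[of 0] A_of_nat[of 1] by simp_all

lemma A_numeral [simp, intro]: "numeral k \<in> A"
  using A_of_nat[of "numeral k"] by simp

lemma A_uminus [simp, intro]: "x \<in> A \<Longrightarrow> - x \<in> A"
  using A_mult[of "- 1" x] A_of_padic_int[of "- 1"] by simp

lemma A_diff [simp, intro]: "x \<in> A \<Longrightarrow> y \<in> A \<Longrightarrow> x - y \<in> A"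
  using A_add[of x "- y"] by simp

lemma A_power [simp, intro]: "x \<in> A \<Longrightarrow> x ^ k \<in> A"
  by (induction k) auto

lemma A_sum [intro!]: "(\<And>i. i \<in> I \<Longrightarrow> f i \<in> A) \<Longrightarrow> sum f I \<in> A"
  by (induction I rule: infinite_finite_induct) auto

lemma A_of_int [simp, intro]: "of_int k \<in> A"
  by (cases k) auto

lemma A_decompose:
  assumes "a \<in> A"
  obtains c a' where "a' \<in> A" "a = of_padic_int c + \<pi> * a'"
proof -
  obtain q where "a = Polynomial.poly (map_poly of_padic_int q) \<pi>"
    using assms by (auto simp: Zp_adjoin_def)
  moreover obtain c q' where "q = pCons c q'" by (cases q)
  ultimately show thesis
    by (intro that[of "Polynomial.poly (map_poly of_padic_int q') \<pi>" c])
      (auto simp: Zp_adjoin_def)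
qed

subsection \<open>Congruences\<close>

lemma pi_congI: "c \<in> A \<Longrightarrow> a - b = \<pi> ^ N * c \<Longrightarrow> pi_cong \<pi> N a b"
  by (auto simp: pi_cong_def)

lemma pi_congE:
  assumes "pi_cong \<pi> N a b"
  obtains c where "c \<in> A" "a = b + \<pi> ^ N * c"
  using assms by (auto simp: pi_cong_def algebra_simps)

lemma pi_cong_refl [simp, intro]: "pi_cong \<pi> N a a"
  by (rule pi_congI[of 0]) auto

lemma pi_cong_sym: "pi_cong \<pi> N a b \<Longrightarrow> pi_cong \<pi> N b a"
  by (elim pi_congE, rule pi_congI[OF A_uminus]) auto

lemma pi_cong_trans [trans]:
  assumes "pi_cong \<pi> N a b" "pi_cong \<pi> N b c" shows "pi_cong \<pi> N a c"
proof -
  obtain x y where "x \<in> A" "y \<in> A" "a = b + \<pi> ^ N * x" "b = c + \<pi> ^ N * y"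
    using assms by (elim pi_congE)
  then show ?thesis by (intro pi_congI[of "x + y"]) (auto simp: algebra_simps)
qed

lemma pi_cong_add:
  assumes "pi_cong \<pi> N a b" "pi_cong \<pi> N c d" shows "pi_cong \<pi> N (a + c) (b + d)"
proof -
  obtain x y where "x \<in> A" "y \<in> A" "a = b + \<pi> ^ N * x" "c = d + \<pi> ^ N * y"
    using assms by (elim pi_congE)
  then show ?thesis by (intro pi_congI[of "x + y"]) (auto simp: algebra_simps)
qed

lemma pi_cong_mult_left:
  assumes "pi_cong \<pi> N a b" "c \<in> A" shows "pi_cong \<pi> N (c * a) (c * b)"
proof -
  obtain x where "x \<in> A" "a = b + \<pi> ^ N * x"
    using assms by (elim pi_congE)
  then show ?thesis using assms(2) by (intro pi_congI[of "c * x"]) (auto simp: algebra_simps)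
qed

lemma pi_cong_mult_right:
  "pi_cong \<pi> N a b \<Longrightarrow> c \<in> A \<Longrightarrow> pi_cong \<pi> N (a * c) (b * c)"
  using pi_cong_mult_left[of N a b c] by (simp add: mult.commute)

lemma pi_cong_mult:
  "pi_cong \<pi> N a b \<Longrightarrow> pi_cong \<pi> N c d \<Longrightarrow> a \<in> A \<Longrightarrow> d \<in> A \<Longrightarrow> pi_cong \<pi> N (a * c) (b * d)"
  by (rule pi_cong_trans[OF pi_cong_mult_left pi_cong_mult_right])

lemma pi_cong_diff:
  assumes "pi_cong \<pi> N a b" "pi_cong \<pi> N c d" shows "pi_cong \<pi> N (a - c) (b - d)"
  using pi_cong_add[OF assms(1) pi_cong_mult_left[OF assms(2) A_uminus[OF A_1]]] by simp

lemma pi_cong_sum: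
  "(\<And>i. i \<in> I \<Longrightarrow> pi_cong \<pi> N (f i) (g i)) \<Longrightarrow> pi_cong \<pi> N (sum f I) (sum g I)"
  by (induction I rule: infinite_finite_induct) (auto intro: pi_cong_add)

lemma pi_cong_power_mult: "pi_cong \<pi> N a b \<Longrightarrow> pi_cong \<pi> (k + N) (\<pi> ^ k * a) (\<pi> ^ k * b)"
  by (auto simp: pi_cong_def power_add algebra_simps simp flip: right_diff_distrib)

lemma pi_cong_mono:
  assumes "pi_cong \<pi> M a b" "N \<le> M" shows "pi_cong \<pi> N a b"
proof -
  obtain c where "c \<in> A" "a = b + \<pi> ^ M * c" using assms(1) by (elim pi_congE)
  then show ?thesis using assms(2)
    by (intro pi_congI[of "\<pi> ^ (M - N) * c"]) (auto simp: power_add[symmetric] simp flip: mult.assoc)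
qed

lemma pi_cong_mem: "pi_cong \<pi> N a b \<Longrightarrow> b \<in> A \<Longrightarrow> a \<in> A"
  by (elim pi_congE) auto

lemma pi_cong_0_iff: "pi_cong \<pi> 0 a b \<longleftrightarrow> a - b \<in> A"
  by (auto simp: pi_cong_def)

subsection \<open>The Eisenstein relation\<close>

lemma pi_nonzero: "\<pi> \<noteq> 0"
proof
  assume "\<pi> = 0"
  then have "of_padic_int (Polynomial.coeff E 0) = 0"
    using root by (cases E) simp
  then have "Polynomial.coeff E 0 = 0" by simp
  then show False using eisenstein by (simp add: eisenstein_def)
qed

lemma of_padic_int_unit:
  assumes "\<not> of_nat CARD('p) dvd (d :: 'p padic_int)"
  obtains d' where "of_padic_int d' * of_padic_int d = 1"
proof -
  obtain d' where "1 = d * d'" using padic_int_unit[OF assms] by (elim dvdE)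
  then have "of_padic_int d' * of_padic_int d = of_padic_int 1"
    by (simp add: mult.commute flip: of_padic_int_mult)
  then show thesis by (intro that) simp
qed

lemma of_padic_int_dvd:
  assumes "of_nat CARD('p) dvd (c :: 'p padic_int)"
  obtains d where "of_padic_int c = P * of_padic_int d"
proof -
  obtain d where "c = of_nat CARD('p) * d" using assms by (elim dvdE)
  then show thesis by (intro that[of d]) simp
qed

lemma eisenstein_relation:
  "(\<Sum>i\<le>e. of_padic_int (Polynomial.coeff E i) * \<pi> ^ i) = 0"
proof -
  have "Polynomial.degree (map_poly of_padic_int E) = e"
    by (rule degree_map_poly) auto
  then show ?thesis using root by (simp add: poly_altdef coeff_map_poly)
qed

lemma lower_coeff:
  "\<exists>d. \<forall>i<e. Polynomial.coeff E i = of_nat CARD('p) * d i"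
  using eisenstein unfolding eisenstein_def dvd_def by metis

text \<open>This is the Eisenstein equation divided by its leading coefficient.\<close>

lemma pi_power_e:
  obtains z where "\<pi> ^ e = P * (\<Sum>i<e. of_padic_int (z i) * \<pi> ^ i)"
proof -
  obtain d where d: "\<And>i. i < e \<Longrightarrow> Polynomial.coeff E i = of_nat CARD('p) * d i"
    using lower_coeff by blast
  obtain l where l: "of_padic_int l * of_padic_int (Polynomial.lead_coeff E) = 1"
    using eisenstein by (auto simp: eisenstein_def elim: of_padic_int_unit)
  have "of_padic_int (Polynomial.lead_coeff E) * \<pi> ^ e
      = - (\<Sum>i<e. of_padic_int (Polynomial.coeff E i) * \<pi> ^ i)"
    using eisenstein_relation by (simp add: lessThan_Suc_atMost[symmetric] eq_neg_iff_add_eq_0 add.commute)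
  then have "(of_padic_int l * of_padic_int (Polynomial.lead_coeff E)) * \<pi> ^ e
      = - of_padic_int l * (\<Sum>i<e. of_padic_int (Polynomial.coeff E i) * \<pi> ^ i)"
    by (simp add: mult.assoc)
  also have "\<dots> = P * (\<Sum>i<e. of_padic_int (- l * d i) * \<pi> ^ i)"
    unfolding sum_distrib_left by (rule sum.cong) (simp_all add: d)
  finally have "\<pi> ^ e = P * (\<Sum>i<e. of_padic_int (- l * d i) * \<pi> ^ i)"
    by (simp only: l mult_1)
  then show thesis by (rule that)
qed

text \<open>The constant coefficient is \<open>p\<close> times a unit, so the equation also expresses \<open>p\<close> through
  \<open>\<pi>\<close>.\<close>

lemma P_times_one_unit:
  obtains u m where "u \<in> A" "m \<in> A" "P * (1 + \<pi> * m) = u * \<pi> ^ e"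
proof -
  obtain d where d: "\<And>i. i < e \<Longrightarrow> Polynomial.coeff E i = of_nat CARD('p) * d i"
    using lower_coeff by blast
  have "\<not> of_nat CARD('p) dvd d 0"
    using eisenstein d[OF e_pos] by (auto simp: eisenstein_def power2_eq_square)
  then obtain d' where d': "of_padic_int d' * of_padic_int (d 0) = 1" by (rule of_padic_int_unit)
  define m where "m = of_padic_int d' * (\<Sum>i\<in>{1..<e}. of_padic_int (d i) * \<pi> ^ (i - 1))"
  define u where "u = - of_padic_int d' * of_padic_int (Polynomial.lead_coeff E)"
  have "0 = (\<Sum>i<e. of_padic_int (Polynomial.coeff E i) * \<pi> ^ i)
      + of_padic_int (Polynomial.lead_coeff E) * \<pi> ^ e"
    using eisenstein_relation by (simp add: lessThan_Suc_atMost[symmetric])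
  also have "(\<Sum>i<e. of_padic_int (Polynomial.coeff E i) * \<pi> ^ i)
      = P * (\<Sum>i<e. of_padic_int (d i) * \<pi> ^ i)"
    unfolding sum_distrib_left by (rule sum.cong) (simp_all add: d)
  also have "(\<Sum>i<e. of_padic_int (d i) * \<pi> ^ i)
      = of_padic_int (d 0) + (\<Sum>i\<in>{1..<e}. of_padic_int (d i) * \<pi> ^ i)"
    using e_pos by (simp add: lessThan_atLeast0 sum.atLeast_Suc_lessThan)
  also have "(\<Sum>i\<in>{1..<e}. of_padic_int (d i) * \<pi> ^ i)
      = \<pi> * (\<Sum>i\<in>{1..<e}. of_padic_int (d i) * \<pi> ^ (i - 1))"
    unfolding sum_distrib_left
    by (rule sum.cong) (auto simp: power_eq_if)
  finally have "of_padic_int d' * 0 = of_padic_int d' * (P * (of_padic_int (d 0)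
      + \<pi> * (\<Sum>i\<in>{1..<e}. of_padic_int (d i) * \<pi> ^ (i - 1)))
      + of_padic_int (Polynomial.lead_coeff E) * \<pi> ^ e)"
    by simp
  also have "\<dots> = P * (of_padic_int d' * of_padic_int (d 0) + \<pi> * m) - u * \<pi> ^ e"
    by (simp add: m_def u_def algebra_simps)
  finally have "P * (1 + \<pi> * m) = u * \<pi> ^ e" using d' by simp
  moreover have "m \<in> A" "u \<in> A"
    unfolding m_def u_def by (intro A_mult A_sum A_uminus A_power A_pi A_of_padic_int)+
  ultimately show thesis by (intro that)
qed

lemma P_in_pi_A:
  obtains t where "t \<in> A" "P = \<pi> * t"
proof -
  obtain u m where um: "u \<in> A" "m \<in> A" "P * (1 + \<pi> * m) = u * \<pi> ^ e" by (rule P_times_one_unit)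
  have "P = \<pi> * (u * \<pi> ^ (e - 1) - P * m)"
    using um(3) e_pos by (simp add: algebra_simps power_eq_if)
  then show thesis using um(1,2) by (intro that[of "u * \<pi> ^ (e - 1) - P * m"]) auto
qed

text \<open>Since \<open>P (1 + \<pi> m)\<close> is a multiple of \<open>\<pi> ^ e\<close>, so is
  \<open>P (1 - (- \<pi> m) ^ e)\<close>, hence \<open>P\<close> itself.\<close>

lemma P_associated_pi_power:
  obtains w w' where "w \<in> A" "w' \<in> A" "w * w' = 1" "P = \<pi> ^ e * w"
proof -
  obtain u m where um: "u \<in> A" "m \<in> A" "P * (1 + \<pi> * m) = u * \<pi> ^ e" by (rule P_times_one_unit)
  define g where "g = (\<Sum>i<e. (- (\<pi> * m)) ^ i)"
  have g: "g \<in> A" using um by (auto simp: g_def)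
  have "(1 + \<pi> * m) * g = 1 - (- (\<pi> * m)) ^ e"
    unfolding g_def using one_diff_power_eq[of "- (\<pi> * m)" e] by simp
  then have "P = P * ((1 + \<pi> * m) * g + (- (\<pi> * m)) ^ e)"
    by simp
  also have "\<dots> = P * (1 + \<pi> * m) * g + P * (- (\<pi> * m)) ^ e"
    by (subst distrib_left) (simp only: mult.assoc)
  also have "\<dots> = \<pi> ^ e * (u * g + P * (- m) ^ e)"
    using um(3) power_mult_distrib[of \<pi> "- m" e] by (simp add: algebra_simps)
  finally have w: "P = \<pi> ^ e * (u * g + P * (- m) ^ e)" .
  obtain z where z: "\<pi> ^ e = P * (\<Sum>i<e. of_padic_int (z i) * \<pi> ^ i)" by (rule pi_power_e)
  let ?w = "u * g + P * (- m) ^ e" and ?w' = "\<Sum>i<e. of_padic_int (z i) * \<pi> ^ i"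
  have "\<pi> ^ e * (?w * ?w') = P * ?w'"
    unfolding mult.assoc[symmetric] w[symmetric] ..
  then have "\<pi> ^ e * (?w * ?w') = \<pi> ^ e * 1"
    using z by simp
  then have "?w * ?w' = 1" using pi_nonzero by simp
  then show thesis using w um g by (intro that[of ?w ?w']) auto
qed

subsection \<open>Completeness\<close>

text \<open>The \<open>Zp\<close>-span of \<open>1, \<pi>, \<dots>, \<pi> ^ (e - 1)\<close> is stable under multiplication by \<open>\<pi>\<close>, since it
  contains \<open>\<pi> ^ e\<close>.\<close>

lemma A_coordinates:
  assumes "a \<in> A"
  shows "\<exists>z. a = (\<Sum>i<e. of_padic_int (z i) * \<pi> ^ i)"
proof -
  define M where "M = {a. \<exists>z. a = (\<Sum>i<e. of_padic_int (z i) * \<pi> ^ i)}"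
  have add: "a + b \<in> M" if "a \<in> M" "b \<in> M" for a b
  proof -
    obtain z z' where "a = (\<Sum>i<e. of_padic_int (z i) * \<pi> ^ i)"
      "b = (\<Sum>i<e. of_padic_int (z' i) * \<pi> ^ i)" using \<open>a \<in> M\<close> \<open>b \<in> M\<close> by (auto simp: M_def)
    then have "a + b = (\<Sum>i<e. of_padic_int (z i + z' i) * \<pi> ^ i)"
      by (simp add: sum.distrib algebra_simps)
    then show ?thesis unfolding M_def by (intro CollectI exI)
  qed
  have scale: "of_padic_int c * a \<in> M" if "a \<in> M" for a c
  proof -
    obtain z where "a = (\<Sum>i<e. of_padic_int (z i) * \<pi> ^ i)" using \<open>a \<in> M\<close> by (auto simp: M_def)
    then have "of_padic_int c * a = (\<Sum>i<e. of_padic_int (c * z i) * \<pi> ^ i)"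
      by (simp add: sum_distrib_left mult.assoc)
    then show ?thesis unfolding M_def by (intro CollectI exI)
  qed
  have pow: "\<pi> ^ j \<in> M" if "j < e" for j
  proof -
    have "(\<Sum>i<e. of_padic_int (if i = j then 1 else 0) * \<pi> ^ i)
        = (\<Sum>i<e. if i = j then \<pi> ^ i else 0)"
      by (rule sum.cong) auto
    then have "\<pi> ^ j = (\<Sum>i<e. of_padic_int (if i = j then 1 else 0) * \<pi> ^ i)"
      using that by simp
    then show ?thesis unfolding M_def by (intro CollectI exI)
  qed
  have sum: "(\<Sum>i\<in>I. f i) \<in> M" if "\<And>i. i \<in> I \<Longrightarrow> f i \<in> M" for I :: "nat set" and f
    using that
  proof (induction I rule: infinite_finite_induct)
    case (insert i I) then show ?case by (simp add: add)
  qed (use scale[OF pow[OF e_pos], of 0] in auto)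
  have pow_e: "\<pi> ^ e \<in> M"
  proof -
    obtain z where "\<pi> ^ e = P * (\<Sum>i<e. of_padic_int (z i) * \<pi> ^ i)" by (rule pi_power_e)
    then have "\<pi> ^ e = of_padic_int (of_nat CARD('p)) * (\<Sum>i<e. of_padic_int (z i) * \<pi> ^ i)"
      by simp
    moreover have "of_padic_int (of_nat CARD('p)) * (\<Sum>i<e. of_padic_int (z i) * \<pi> ^ i) \<in> M"
      by (intro scale sum pow) auto
    ultimately show ?thesis by simp
  qed
  have shift: "\<pi> * a \<in> M" if "a \<in> M" for a
  proof -
    obtain z where "a = (\<Sum>i<e. of_padic_int (z i) * \<pi> ^ i)" using \<open>a \<in> M\<close> by (auto simp: M_def)
    then have a: "\<pi> * a = (\<Sum>i<e. of_padic_int (z i) * \<pi> ^ Suc i)"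
      by (simp add: sum_distrib_left mult.left_commute)
    have "\<pi> ^ Suc i \<in> M" if "i < e" for i
      using pow[of "Suc i"] pow_e that by (cases "Suc i = e") auto
    then show ?thesis unfolding a by (intro sum scale) auto
  qed
  have "Polynomial.poly (map_poly of_padic_int q) \<pi> \<in> M" for q
  proof (induction q)
    case 0
    then show ?case using sum[of "{}"] by simp
  next
    case (pCons c q)
    then show ?case
      using add[OF scale[OF pow[OF e_pos], of c] shift] by simp
  qed
  then show ?thesis using assms by (auto simp: M_def Zp_adjoin_def)
qed

text \<open>Grouping the terms of \<open>\<Sum>k. \<pi> ^ k c\<^sub>k\<close> by blocks of length \<open>e\<close>, where \<open>\<pi> ^ e = P w\<close>, turns the
  series into a series in powers of \<open>P\<close>, which converges coordinatewise with respect to the generators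
  \<open>1, \<pi>, \<dots>, \<pi> ^ (e - 1)\<close>.\<close>

lemma A_complete:
  assumes c: "\<And>k. c k \<in> A"
  shows "\<exists>s\<in>A. \<forall>N. pi_cong \<pi> N s (\<Sum>k<N. \<pi> ^ k * c k)"
proof -
  obtain w where w: "w \<in> A" "\<pi> ^ e = P * w"
  proof -
    obtain z where "\<pi> ^ e = P * (\<Sum>i<e. of_padic_int (z i) * \<pi> ^ i)" by (rule pi_power_e)
    then show thesis by (intro that[of "\<Sum>i<e. of_padic_int (z i) * \<pi> ^ i"]) auto
  qed
  define b where "b q = (\<Sum>j<e. w ^ q * \<pi> ^ j * c (j + q * e))" for q
  have b: "b q \<in> A" for q using w(1) c by (auto simp: b_def)
  obtain z where z: "\<And>q. b q = (\<Sum>i<e. of_padic_int (z q i) * \<pi> ^ i)"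
    using A_coordinates[OF b] by metis
  have "\<exists>s. \<forall>N. of_nat CARD('p) ^ N dvd s - (\<Sum>q<N. of_nat CARD('p) ^ q * z q i)" for i
    using padic_int_complete[of "\<lambda>q. z q i"] by blast
  then obtain s where
    s: "\<And>i N. of_nat CARD('p) ^ N dvd s i - (\<Sum>q<N. of_nat CARD('p) ^ q * z q i)"
    by metis
  define t where "t = (\<Sum>i<e. of_padic_int (s i) * \<pi> ^ i)"
  have blocks: "(\<Sum>k<N * e. \<pi> ^ k * c k) = (\<Sum>q<N. P ^ q * b q)" for N
  proof (induction N)
    case (Suc N)
    have "(\<Sum>k<Suc N * e. \<pi> ^ k * c k)
        = (\<Sum>k<N * e. \<pi> ^ k * c k) + (\<Sum>k=N * e..<N * e + e. \<pi> ^ k * c k)"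
      by (simp add: lessThan_atLeast0 sum.atLeastLessThan_concat add.commute)
    also have "(\<Sum>k=N * e..<N * e + e. \<pi> ^ k * c k) = (\<Sum>j<e. \<pi> ^ (j + N * e) * c (j + N * e))"
      using sum.shift_bounds_nat_ivl[of "\<lambda>k. \<pi> ^ k * c k" 0 "N * e" e]
      by (simp add: lessThan_atLeast0 add.commute)
    also have "\<dots> = P ^ N * b N"
    proof -
      have "\<pi> ^ (j + N * e) = P ^ N * (w ^ N * \<pi> ^ j)" for j
      proof -
        have "\<pi> ^ (j + N * e) = (\<pi> ^ e) ^ N * \<pi> ^ j"
          by (simp only: power_add power_mult[symmetric] mult.commute)
        then show ?thesis by (simp only: w(2) power_mult_distrib mult.assoc)
      qed
      then show ?thesis by (simp add: b_def sum_distrib_left mult.assoc)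
    qed
    finally show ?case using Suc.IH by simp
  qed simp
  obtain p' where p': "p' \<in> A" "P = \<pi> * p'" by (rule P_in_pi_A)
  show ?thesis
  proof (intro bexI allI)
    show "t \<in> A" by (auto simp: t_def)
  next
    fix N
    have "\<exists>d. s i - (\<Sum>q<N. of_nat CARD('p) ^ q * z q i) = of_nat CARD('p) ^ N * d" for i
      using s[of N i] by (auto simp: dvd_def)
    then obtain d where d: "\<And>i. s i - (\<Sum>q<N. of_nat CARD('p) ^ q * z q i) = of_nat CARD('p) ^ N * d i"
      by metis
    have "of_padic_int (s i) - (\<Sum>q<N. P ^ q * of_padic_int (z q i)) = P ^ N * of_padic_int (d i)" for i
      using arg_cong[OF d[of i], of of_padic_int] by (simp add: of_padic_int_sum)
    then have si: "of_padic_int (s i) = (\<Sum>q<N. P ^ q * of_padic_int (z q i)) + P ^ N * of_padic_int (d i)" for i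
      by (simp add: algebra_simps)
    have "t = (\<Sum>i<e. \<Sum>q<N. P ^ q * (of_padic_int (z q i) * \<pi> ^ i)) + P ^ N * (\<Sum>i<e. of_padic_int (d i) * \<pi> ^ i)"
      by (simp add: t_def si distrib_right sum.distrib sum_distrib_left sum_distrib_right mult.assoc)
    also have "(\<Sum>i<e. \<Sum>q<N. P ^ q * (of_padic_int (z q i) * \<pi> ^ i)) = (\<Sum>q<N. P ^ q * b q)"
      by (subst sum.swap) (simp add: z sum_distrib_left)
    finally have "pi_cong \<pi> N t (\<Sum>q<N. P ^ q * b q)"
      using p' by (intro pi_congI[of "p' ^ N * (\<Sum>i<e. of_padic_int (d i) * \<pi> ^ i)"])
        (auto simp: power_mult_distrib mult.assoc intro!: A_mult)
    also have "(\<Sum>q<N. P ^ q * b q) = (\<Sum>k<N. \<pi> ^ k * c k) + (\<Sum>k=N..<N * e. \<pi> ^ k * c k)"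
      using e_pos unfolding blocks[symmetric]
      by (simp add: lessThan_atLeast0 sum.atLeastLessThan_concat)
    also have "pi_cong \<pi> N \<dots> ((\<Sum>k<N. \<pi> ^ k * c k) + (\<Sum>k=N..<N * e. 0))"
    proof (intro pi_cong_add pi_cong_refl pi_cong_sum)
      fix k assume "k \<in> {N..<N * e}"
      then have "N \<le> k" by simp
      moreover have "pi_cong \<pi> k (\<pi> ^ k * c k) 0"
        using pi_cong_power_mult[of 0 "c k" 0 k] c by (simp add: pi_cong_0_iff)
      ultimately show "pi_cong \<pi> N (\<pi> ^ k * c k) 0" using pi_cong_mono by simp
    qed
    finally show "pi_cong \<pi> N t (\<Sum>k<N. \<pi> ^ k * c k)" by simp
  qed
qed

lemma A_residue:
  assumes "a \<in> A"
  obtains j where "j < CARD('p)" "pi_cong \<pi> 1 a (of_nat j)"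
proof -
  obtain c a' where a: "a' \<in> A" "a = of_padic_int c + \<pi> * a'" using assms by (rule A_decompose)
  obtain j where j: "j < CARD('p)" "of_nat CARD('p) dvd c - of_nat j" by (rule padic_int_residue)
  obtain d where "of_padic_int (c - of_nat j) = P * of_padic_int d"
    using j(2) by (rule of_padic_int_dvd)
  moreover obtain p' where "p' \<in> A" "P = \<pi> * p'" by (rule P_in_pi_A)
  ultimately have "pi_cong \<pi> 1 a (of_nat j)"
    using a by (intro pi_congI[of "p' * of_padic_int d + a'"]) (auto simp: algebra_simps)
  then show thesis using that j(1) by blast
qed

lemma int_unit_mod_pi:
  assumes "\<not> int CARD('p) dvd j"
  obtains k where "pi_cong \<pi> 1 (of_int j * of_int k) 1"
proof -
  obtain k m where "j * k = 1 + int CARD('p) * m" using assms by (rule inverse_mod_prime_card)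
  then have "of_int j * of_int k = (1 + P * of_int m :: 'p Qp_closure)"
    by (metis of_int_1 of_int_add of_int_mult of_int_of_nat_eq)
  moreover obtain p' where "p' \<in> A" "P = \<pi> * p'" by (rule P_in_pi_A)
  ultimately show thesis
    by (intro that[of k] pi_congI[of "p' * of_int m"]) (auto simp: algebra_simps)
qed

section \<open>Polynomial and restricted power series functions\<close>

text \<open>The algebra of functions on \<open>A\<close> generated over \<open>A\<close> by the coordinates \<open>y i\<close>. The
  last rule is there because values outside \<open>A\<close> are arbitrary, so that identities between such
  functions are only available on \<open>A\<close>.\<close>

inductive_set poly_funs ::
    "'i set \<Rightarrow> ('i \<Rightarrow> 'p Qp_closure \<Rightarrow> 'p Qp_closure) \<Rightarrow> ('p Qp_closure \<Rightarrow> 'p Qp_closure) set"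
  for W :: "'i set" and y :: "'i \<Rightarrow> 'p Qp_closure \<Rightarrow> 'p Qp_closure"
where
  const: "c \<in> A \<Longrightarrow> (\<lambda>_. c) \<in> poly_funs W y"
| coord: "i \<in> W \<Longrightarrow> y i \<in> poly_funs W y"
| add: "f \<in> poly_funs W y \<Longrightarrow> g \<in> poly_funs W y \<Longrightarrow> (\<lambda>u. f u + g u) \<in> poly_funs W y"
| mult: "f \<in> poly_funs W y \<Longrightarrow> g \<in> poly_funs W y \<Longrightarrow> (\<lambda>u. f u * g u) \<in> poly_funs W y"
| eq_on: "f \<in> poly_funs W y \<Longrightarrow> (\<And>u. u \<in> A \<Longrightarrow> g u = f u) \<Longrightarrow> g \<in> poly_funs W y"

lemmas poly_funs_intros = poly_funs.const poly_funs.coord poly_funs.add poly_funs.mult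

definition maps_A :: "'i set \<Rightarrow> ('i \<Rightarrow> 'p Qp_closure \<Rightarrow> 'p Qp_closure) \<Rightarrow> bool" where
  "maps_A W y \<longleftrightarrow> (\<forall>i\<in>W. \<forall>u\<in>A. y i u \<in> A)"

lemma poly_funs_scale: "c \<in> A \<Longrightarrow> f \<in> poly_funs W y \<Longrightarrow> (\<lambda>u. c * f u) \<in> poly_funs W y"
  by (intro poly_funs_intros)

lemma poly_funs_diff:
  assumes "f \<in> poly_funs W y" "g \<in> poly_funs W y" shows "(\<lambda>u. f u - g u) \<in> poly_funs W y"
  using poly_funs.add[OF assms(1) poly_funs_scale[OF _ assms(2), of "- 1"]] by simp

lemma poly_funs_power: "f \<in> poly_funs W y \<Longrightarrow> (\<lambda>u. f u ^ k) \<in> poly_funs W y"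
  by (induction k) (auto intro: poly_funs_intros)

lemma poly_funs_sum:
  "(\<And>i. i \<in> I \<Longrightarrow> f i \<in> poly_funs W y) \<Longrightarrow> (\<lambda>u. \<Sum>i\<in>I. f i u) \<in> poly_funs W y"
  by (induction I rule: infinite_finite_induct) (auto intro: poly_funs_intros)

lemma poly_funs_prod:
  "(\<And>i. i \<in> I \<Longrightarrow> f i \<in> poly_funs W y) \<Longrightarrow> (\<lambda>u. \<Prod>i\<in>I. f i u) \<in> poly_funs W y"
  by (induction I rule: infinite_finite_induct) (auto intro: poly_funs_intros)

lemma poly_funs_mem: "f \<in> poly_funs W y \<Longrightarrow> maps_A W y \<Longrightarrow> u \<in> A \<Longrightarrow> f u \<in> A"
  by (induction rule: poly_funs.induct) (auto simp: maps_A_def)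

lemma poly_funs_subset:
  assumes "\<And>i. i \<in> W \<Longrightarrow> y i \<in> poly_funs W' y'"
  shows "poly_funs W y \<subseteq> poly_funs W' y'"
proof
  fix f assume "f \<in> poly_funs W y"
  then show "f \<in> poly_funs W' y'"
  proof induction
    case (eq_on f g)
    then show ?case by (blast intro: poly_funs.eq_on)
  next
    case (coord i)
    then show ?case by (rule assms)
  qed (auto intro: poly_funs_intros)
qed

lemma poly_funs_comp:
  assumes "f \<in> poly_funs W y" "\<And>u. u \<in> A \<Longrightarrow> h u \<in> A"
  shows "(\<lambda>u. f (h u)) \<in> poly_funs W (\<lambda>i u. y i (h u))"
  using assms(1)
proof induction
  case (coord i)
  then show ?case by (rule poly_funs.coord[of _ _ "\<lambda>i u. y i (h u)"])
next
  case (eq_on f g)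
  then show ?case using assms(2) by (auto intro: poly_funs.eq_on)
qed (auto intro: poly_funs_intros)

lemma poly_funs_comp_lift:
  assumes "g \<in> poly_funs W (\<lambda>i u. y i (h u))"
  shows "\<exists>f \<in> poly_funs W y. \<forall>u\<in>A. g u = f (h u)"
  using assms
proof induction
  case (add f g)
  then obtain f' g' where "f' \<in> poly_funs W y" "g' \<in> poly_funs W y"
    "\<forall>u\<in>A. f u = f' (h u)" "\<forall>u\<in>A. g u = g' (h u)" by blast
  then show ?case by (intro bexI[OF _ poly_funs.add[of f' _ _ g']]) auto
next
  case (mult f g)
  then obtain f' g' where "f' \<in> poly_funs W y" "g' \<in> poly_funs W y"
    "\<forall>u\<in>A. f u = f' (h u)" "\<forall>u\<in>A. g u = g' (h u)" by blast
  then show ?case by (intro bexI[OF _ poly_funs.mult[of f' _ _ g']]) auto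
next
  case (const c)
  then show ?case by (intro bexI[OF _ poly_funs.const[of c]]) auto
next
  case (coord i)
  then show ?case by (intro bexI[OF _ poly_funs.coord[of i]]) auto
next
  case (eq_on f g)
  then show ?case by auto
qed

text \<open>A ring endomorphism \<open>h\<close> of \<open>A\<close> is applied to the coefficients and to the coordinates; the
  intended \<open>h\<close> is a lift of Frobenius.\<close>

lemma poly_funs_hom:
  assumes "f \<in> poly_funs W y" "maps_A W y"
    and hom: "\<And>a b. a \<in> A \<Longrightarrow> b \<in> A \<Longrightarrow> h (a + b) = h a + h b"
      "\<And>a b. a \<in> A \<Longrightarrow> b \<in> A \<Longrightarrow> h (a * b) = h a * h b" "\<And>a. a \<in> A \<Longrightarrow> h a \<in> A"
    and y': "\<And>i. i \<in> W \<Longrightarrow> (\<lambda>u. h (y i u)) \<in> poly_funs W' y'"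
  shows "(\<lambda>u. h (f u)) \<in> poly_funs W' y'"
  using assms(1)
proof induction
  case (const c)
  then show ?case by (intro poly_funs.const hom)
next
  case (coord i)
  then show ?case by (rule y')
next
  case (add f g)
  show ?case
    by (rule poly_funs.eq_on[OF poly_funs.add[OF add.IH]])
      (use add.hyps assms(2) in \<open>auto intro: hom poly_funs_mem\<close>)
next
  case (mult f g)
  show ?case
    by (rule poly_funs.eq_on[OF poly_funs.mult[OF mult.IH]])
      (use mult.hyps assms(2) in \<open>auto intro: hom poly_funs_mem\<close>)
next
  case (eq_on f g)
  then show ?case by (auto intro: poly_funs.eq_on)
qed

text \<open>Sums \<open>\<Sum>k. \<pi> ^ k g k\<close> of polynomial functions. These are the functions given by restricted
  power series in the coordinates. Uniform limits of polynomial functions form a larger class: a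
  polynomial all of whose values are divisible by \<open>\<pi> ^ k\<close>, such as a power of \<open>x ^ p - x\<close>, need not be
  \<open>\<pi> ^ k\<close> times a polynomial with coefficients in \<open>A\<close>. Hence the factors \<open>\<pi> ^ k\<close> are kept
  explicitly.\<close>

definition series_funs ::
    "'i set \<Rightarrow> ('i \<Rightarrow> 'p Qp_closure \<Rightarrow> 'p Qp_closure) \<Rightarrow> ('p Qp_closure \<Rightarrow> 'p Qp_closure) set" where
  "series_funs W y = {f. \<exists>g. (\<forall>k. g k \<in> poly_funs W y) \<and>
     (\<forall>u\<in>A. \<forall>N. pi_cong \<pi> N (f u) (\<Sum>k<N. \<pi> ^ k * g k u))}"

lemma series_funsI:
  assumes "\<And>k. g k \<in> poly_funs W y"
    and "\<And>u N. u \<in> A \<Longrightarrow> pi_cong \<pi> N (f u) (\<Sum>k<N. \<pi> ^ k * g k u)"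
  shows "f \<in> series_funs W y"
  using assms by (auto simp: series_funs_def)

lemma series_funsE:
  assumes "f \<in> series_funs W y"
  obtains g where "\<forall>k. g k \<in> poly_funs W y"
    "\<forall>u N. u \<in> A \<longrightarrow> pi_cong \<pi> N (f u) (\<Sum>k<N. \<pi> ^ k * g k u)"
  using assms by (auto simp: series_funs_def)

lemma series_funs_mem: "f \<in> series_funs W y \<Longrightarrow> u \<in> A \<Longrightarrow> f u \<in> A"
proof (elim series_funsE)
  fix h assume "u \<in> A" "\<forall>u N. u \<in> A \<longrightarrow> pi_cong \<pi> N (f u) (\<Sum>k<N. \<pi> ^ k * h k u)"
  then have "pi_cong \<pi> 0 (f u) (\<Sum>k<0. \<pi> ^ k * h k u)" by blast
  then show "f u \<in> A" by (rule pi_cong_mem) simp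
qed

lemma series_funs_cong:
  assumes "f \<in> series_funs W y" "\<And>u N. u \<in> A \<Longrightarrow> pi_cong \<pi> N (g u) (f u)"
  shows "g \<in> series_funs W y"
proof -
  obtain h where "\<forall>k. h k \<in> poly_funs W y"
    "\<forall>u N. u \<in> A \<longrightarrow> pi_cong \<pi> N (f u) (\<Sum>k<N. \<pi> ^ k * h k u)" using assms(1) by (rule series_funsE)
  then show ?thesis
    by (intro series_funsI[of h] pi_cong_trans[OF assms(2)]) auto
qed

lemma series_funs_mono: "poly_funs W y \<subseteq> poly_funs W' y' \<Longrightarrow> series_funs W y \<subseteq> series_funs W' y'"
  by (auto simp: series_funs_def)

lemma sum_delta_first:
  "(\<Sum>k<N. \<pi> ^ k * (if k = 0 then f else 0)) = (if N = 0 then 0 else f)"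
  by (induction N) auto

lemma poly_funs_subset_series_funs:
  assumes "maps_A W y"
  shows "poly_funs W y \<subseteq> series_funs W y"
proof
  fix f assume f: "f \<in> poly_funs W y"
  show "f \<in> series_funs W y"
  proof (rule series_funsI[of "\<lambda>k. if k = 0 then f else (\<lambda>_. 0)"])
    fix u N assume "u \<in> A"
    have "(\<Sum>k<N. \<pi> ^ k * (if k = 0 then f else (\<lambda>_. 0)) u)
        = (\<Sum>k<N. \<pi> ^ k * (if k = 0 then f u else 0))"
      by (rule sum.cong) auto
    also have "\<dots> = (if N = 0 then 0 else f u)" by (rule sum_delta_first)
    finally show "pi_cong \<pi> N (f u) (\<Sum>k<N. \<pi> ^ k * (if k = 0 then f else (\<lambda>_. 0)) u)"
      using poly_funs_mem[OF f assms \<open>u \<in> A\<close>] by (auto simp: pi_cong_0_iff)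
  next
    show "(if k = 0 then f else (\<lambda>_. 0)) \<in> poly_funs W y" for k :: nat
      using f by (simp add: poly_funs.const)
  qed
qed

text \<open>A double series \<open>\<Sum>j. \<pi> ^ j (\<Sum>i. \<pi> ^ i g j i)\<close> is summed along its diagonals.\<close>

lemma series_funs_series:
  assumes f: "\<And>k. f k \<in> series_funs W y"
    and h: "\<And>u N. u \<in> A \<Longrightarrow> pi_cong \<pi> N (h u) (\<Sum>k<N. \<pi> ^ k * f k u)"
  shows "h \<in> series_funs W y"
proof -
  have "\<forall>k. \<exists>g. (\<forall>i. g i \<in> poly_funs W y) \<and>
      (\<forall>u N. u \<in> A \<longrightarrow> pi_cong \<pi> N (f k u) (\<Sum>i<N. \<pi> ^ i * g i u))"
    using f unfolding series_funs_def by blast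
  then obtain g where g: "\<And>k i. g k i \<in> poly_funs W y"
    "\<And>k u N. u \<in> A \<Longrightarrow> pi_cong \<pi> N (f k u) (\<Sum>i<N. \<pi> ^ i * g k i u)"
    by metis
  show ?thesis
  proof (rule series_funsI[of "\<lambda>k u. \<Sum>j\<le>k. g j (k - j) u"])
    show "(\<lambda>u. \<Sum>j\<le>k. g j (k - j) u) \<in> poly_funs W y" for k
      by (intro poly_funs_sum g)
    fix u N assume u: "u \<in> A"
    have "pi_cong \<pi> N (\<Sum>j<N. \<pi> ^ j * f j u) (\<Sum>j<N. \<pi> ^ j * (\<Sum>i<N - j. \<pi> ^ i * g j i u))"
    proof (rule pi_cong_sum)
      fix j assume "j \<in> {..<N}"
      then show "pi_cong \<pi> N (\<pi> ^ j * f j u) (\<pi> ^ j * (\<Sum>i<N - j. \<pi> ^ i * g j i u))"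
        using pi_cong_power_mult[OF g(2)[OF u, of "N - j" j], of j] by simp
    qed
    also have "(\<Sum>j<N. \<pi> ^ j * (\<Sum>i<N - j. \<pi> ^ i * g j i u))
        = (\<Sum>j<N. \<Sum>i<N - j. \<pi> ^ (j + i) * g j i u)"
      by (simp add: sum_distrib_left power_add mult.assoc)
    also have "\<dots> = (\<Sum>(j, i)\<in>(SIGMA j:{..<N}. {..<N - j}). \<pi> ^ (j + i) * g j i u)"
      by (rule sum.Sigma) auto
    also have "(SIGMA j:{..<N}. {..<N - j}) = {(j, i). j + i < N}" by auto
    also have "(\<Sum>(j, i)\<in>{(j, i). j + i < N}. \<pi> ^ (j + i) * g j i u)
        = (\<Sum>k<N. \<Sum>j\<le>k. \<pi> ^ (j + (k - j)) * g j (k - j) u)"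
      by (rule sum.triangle_reindex)
    also have "\<dots> = (\<Sum>k<N. \<pi> ^ k * (\<Sum>j\<le>k. g j (k - j) u))"
      by (simp add: sum_distrib_left)
    finally show "pi_cong \<pi> N (h u) (\<Sum>k<N. \<pi> ^ k * (\<Sum>j\<le>k. g j (k - j) u))"
      by (rule pi_cong_trans[OF h[OF u]])
  qed
qed

lemma series_funs_add:
  assumes "f \<in> series_funs W y" "g \<in> series_funs W y"
  shows "(\<lambda>u. f u + g u) \<in> series_funs W y"
proof -
  obtain f' where f': "\<forall>k. f' k \<in> poly_funs W y"
    "\<forall>u N. u \<in> A \<longrightarrow> pi_cong \<pi> N (f u) (\<Sum>k<N. \<pi> ^ k * f' k u)" using assms(1) by (rule series_funsE)
  obtain g' where g': "\<forall>k. g' k \<in> poly_funs W y"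
    "\<forall>u N. u \<in> A \<longrightarrow> pi_cong \<pi> N (g u) (\<Sum>k<N. \<pi> ^ k * g' k u)" using assms(2) by (rule series_funsE)
  show ?thesis
  proof (rule series_funsI[of "\<lambda>k u. f' k u + g' k u"])
    show "(\<lambda>u. f' k u + g' k u) \<in> poly_funs W y" for k
      using f'(1) g'(1) by (intro poly_funs.add) auto
    fix u N assume "u \<in> A"
    then have "pi_cong \<pi> N (f u + g u) ((\<Sum>k<N. \<pi> ^ k * f' k u) + (\<Sum>k<N. \<pi> ^ k * g' k u))"
      using f'(2) g'(2) by (intro pi_cong_add) auto
    then show "pi_cong \<pi> N (f u + g u) (\<Sum>k<N. \<pi> ^ k * (f' k u + g' k u))"
      by (simp only: distrib_left sum.distrib)
  qed
qed

lemma series_funs_mult_poly: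
  assumes "f \<in> poly_funs W y" "g \<in> series_funs W y" "maps_A W y"
  shows "(\<lambda>u. f u * g u) \<in> series_funs W y"
proof -
  obtain g' where g': "\<forall>k. g' k \<in> poly_funs W y"
    "\<forall>u N. u \<in> A \<longrightarrow> pi_cong \<pi> N (g u) (\<Sum>k<N. \<pi> ^ k * g' k u)" using assms(2) by (rule series_funsE)
  show ?thesis
  proof (rule series_funsI[of "\<lambda>k u. f u * g' k u"])
    fix u N assume u: "u \<in> A"
    have "pi_cong \<pi> N (f u * g u) (f u * (\<Sum>k<N. \<pi> ^ k * g' k u))"
      using g' u by (intro pi_cong_mult_left poly_funs_mem[OF assms(1,3)]) auto
    then show "pi_cong \<pi> N (f u * g u) (\<Sum>k<N. \<pi> ^ k * (f u * g' k u))"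
      by (simp add: sum_distrib_left mult.left_commute)
  next
    show "(\<lambda>u. f u * g' k u) \<in> poly_funs W y" for k
      using g'(1) assms(1) by (intro poly_funs.mult) auto
  qed
qed

lemma series_funs_mult:
  assumes "f \<in> series_funs W y" "g \<in> series_funs W y" "maps_A W y"
  shows "(\<lambda>u. f u * g u) \<in> series_funs W y"
proof -
  obtain f' where f': "\<forall>k. f' k \<in> poly_funs W y"
    "\<forall>u N. u \<in> A \<longrightarrow> pi_cong \<pi> N (f u) (\<Sum>k<N. \<pi> ^ k * f' k u)" using assms(1) by (rule series_funsE)
  show ?thesis
  proof (rule series_funs_series[of "\<lambda>k u. f' k u * g u"])
    fix u N assume u: "u \<in> A"
    have "pi_cong \<pi> N (f u * g u) ((\<Sum>k<N. \<pi> ^ k * f' k u) * g u)"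
      using f' u by (intro pi_cong_mult_right series_funs_mem[OF assms(2)]) auto
    then show "pi_cong \<pi> N (f u * g u) (\<Sum>k<N. \<pi> ^ k * (f' k u * g u))"
      by (simp add: sum_distrib_right mult.assoc)
  next
    show "(\<lambda>u. f' k u * g u) \<in> series_funs W y" for k
      using series_funs_mult_poly[OF spec[OF f'(1)] assms(2,3)] .
  qed
qed

lemma series_funs_const:
  assumes "c \<in> A" "maps_A W y" shows "(\<lambda>_. c) \<in> series_funs W y"
  using poly_funs_subset_series_funs[OF assms(2)] poly_funs.const[OF assms(1)] by (rule subsetD)

lemma series_funs_sum:
  assumes "maps_A W y" "\<And>i. i \<in> I \<Longrightarrow> f i \<in> series_funs W y"
  shows "(\<lambda>u. \<Sum>i\<in>I. f i u) \<in> series_funs W y"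
  using assms(2)
proof (induction I rule: infinite_finite_induct)
  case (insert i I)
  have "(\<lambda>u. f i u + (\<Sum>j\<in>I. f j u)) \<in> series_funs W y"
    by (intro series_funs_add insert.IH insert.prems) auto
  then show ?case using insert.hyps by simp
next
  case (infinite I)
  then show ?case using series_funs_const[OF A_0 assms(1)] by simp
next
  case empty
  then show ?case using series_funs_const[OF A_0 assms(1)] by simp
qed

lemma series_funs_exists_sum:
  assumes "\<And>k. g k \<in> poly_funs W y" "maps_A W y"
  shows "\<exists>f\<in>series_funs W y. \<forall>u\<in>A. \<forall>N. pi_cong \<pi> N (f u) (\<Sum>k<N. \<pi> ^ k * g k u)"
proof -
  have "\<forall>u\<in>A. \<exists>s. \<forall>N. pi_cong \<pi> N s (\<Sum>k<N. \<pi> ^ k * g k u)"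
    using A_complete[of "\<lambda>k. g k u" for u] poly_funs_mem[OF assms] by blast
  then obtain f where "\<forall>u\<in>A. \<forall>N. pi_cong \<pi> N (f u) (\<Sum>k<N. \<pi> ^ k * g k u)" by metis
  then show ?thesis using assms(1) by (intro bexI[of _ f] series_funsI) auto
qed

lemma series_funs_comp:
  assumes "f \<in> series_funs W y" "\<And>u. u \<in> A \<Longrightarrow> h u \<in> A"
  shows "(\<lambda>u. f (h u)) \<in> series_funs W (\<lambda>i u. y i (h u))"
proof -
  obtain g where g: "\<forall>k. g k \<in> poly_funs W y"
    "\<forall>u N. u \<in> A \<longrightarrow> pi_cong \<pi> N (f u) (\<Sum>k<N. \<pi> ^ k * g k u)" using assms(1) by (rule series_funsE)
  show ?thesis
  proof (rule series_funsI[of "\<lambda>k u. g k (h u)"])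
    show "(\<lambda>u. g k (h u)) \<in> poly_funs W (\<lambda>i u. y i (h u))" for k
      using poly_funs_comp[OF spec[OF g(1)] assms(2)] .
    show "pi_cong \<pi> N (f (h u)) (\<Sum>k<N. \<pi> ^ k * g k (h u))" if "u \<in> A" for u N
      using g(2) assms(2)[OF that] by blast
  qed
qed

text \<open>A series in the coordinates restricted to the image of \<open>h\<close> extends to all of \<open>A\<close>: its terms
  extend as polynomials, and by completeness the series of the extended terms converges
  everywhere.\<close>

lemma series_funs_comp_lift:
  assumes "g \<in> series_funs W (\<lambda>i u. y i (h u))" "maps_A W y" "\<And>u. u \<in> A \<Longrightarrow> h u \<in> A"
  shows "\<exists>f \<in> series_funs W y. \<forall>u\<in>A. \<forall>N. pi_cong \<pi> N (f (h u)) (g u)"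
proof -
  obtain g' where g': "\<forall>k. g' k \<in> poly_funs W (\<lambda>i u. y i (h u))"
    "\<forall>u N. u \<in> A \<longrightarrow> pi_cong \<pi> N (g u) (\<Sum>k<N. \<pi> ^ k * g' k u)" using assms(1) by (rule series_funsE)
  have "\<exists>f'. f' \<in> poly_funs W y \<and> (\<forall>u\<in>A. g' k u = f' (h u))" for k
    using poly_funs_comp_lift[of "g' k" W y h, OF spec[OF g'(1)]] by blast
  then obtain f' where f': "\<And>k. f' k \<in> poly_funs W y" "\<And>k u. u \<in> A \<Longrightarrow> g' k u = f' k (h u)"
    by metis
  obtain f where f: "f \<in> series_funs W y"
    "\<forall>u\<in>A. \<forall>N. pi_cong \<pi> N (f u) (\<Sum>k<N. \<pi> ^ k * f' k u)"
    using series_funs_exists_sum[of f', OF f'(1) assms(2)] by blast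
  have "pi_cong \<pi> N (f (h u)) (g u)" if "u \<in> A" for u N
  proof -
    have "pi_cong \<pi> N (f (h u)) (\<Sum>k<N. \<pi> ^ k * f' k (h u))" using f(2) assms(3) that by blast
    also have "(\<Sum>k<N. \<pi> ^ k * f' k (h u)) = (\<Sum>k<N. \<pi> ^ k * g' k u)" using f'(2) that by simp
    also have "pi_cong \<pi> N \<dots> (g u)" using g'(2) that by (blast intro: pi_cong_sym)
    finally show ?thesis .
  qed
  then show ?thesis using f(1) by blast
qed

text \<open>Successive approximation: each polynomial in the \<open>y\<^sub>i\<close> is, modulo \<open>\<pi>\<close> times another one, a
  polynomial in the \<open>z\<^sub>j\<close>, and iterating this expands it as a series in powers of \<open>\<pi>\<close>.\<close>

lemma series_funs_change_of_coordinates: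
  assumes y: "maps_A W y"
    and z: "\<And>j. j \<in> W' \<Longrightarrow> z j \<in> poly_funs W y"
    and yz: "\<And>i. i \<in> W \<Longrightarrow> \<exists>f \<in> poly_funs W' z. \<exists>g \<in> poly_funs W y. \<forall>u\<in>A. y i u = f u + \<pi> * g u"
  shows "series_funs W y \<subseteq> series_funs W' z"
proof -
  have zy: "f \<in> poly_funs W y" if "f \<in> poly_funs W' z" for f
    using that by (rule subsetD[OF poly_funs_subset, rotated]) (rule z)
  have step: "\<exists>f \<in> poly_funs W' z. \<exists>g \<in> poly_funs W y. \<forall>u\<in>A. h u = f u + \<pi> * g u"
    if "h \<in> poly_funs W y" for h
    using that
  proof induction
    case (const c)
    then show ?case
      by (intro bexI[OF _ poly_funs.const[of c]] bexI[OF _ poly_funs.const[of 0]]) auto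
  next
    case (coord i)
    then show ?case by (rule yz)
  next
    case (add h1 h2)
    then obtain f1 g1 f2 g2 where *: "f1 \<in> poly_funs W' z" "f2 \<in> poly_funs W' z"
      "g1 \<in> poly_funs W y" "g2 \<in> poly_funs W y"
      "\<forall>u\<in>A. h1 u = f1 u + \<pi> * g1 u" "\<forall>u\<in>A. h2 u = f2 u + \<pi> * g2 u"
      by blast
    show ?case
      by (intro bexI[OF _ poly_funs.add[OF *(1,2)]] bexI[OF _ poly_funs.add[OF *(3,4)]])
        (use * in \<open>auto simp: algebra_simps\<close>)
  next
    case (mult h1 h2)
    then obtain f1 g1 f2 g2 where *: "f1 \<in> poly_funs W' z" "f2 \<in> poly_funs W' z"
      "g1 \<in> poly_funs W y" "g2 \<in> poly_funs W y"
      "\<forall>u\<in>A. h1 u = f1 u + \<pi> * g1 u" "\<forall>u\<in>A. h2 u = f2 u + \<pi> * g2 u"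
      by blast
    have g: "(\<lambda>u. f1 u * g2 u + g1 u * h2 u) \<in> poly_funs W y"
      by (rule poly_funs.add[OF poly_funs.mult[OF zy[OF *(1)] *(4)] poly_funs.mult[OF *(3) mult.hyps(2)]])
    show ?case
      by (intro bexI[OF _ poly_funs.mult[OF *(1,2)]] bexI[OF _ g])
        (use * in \<open>auto simp: algebra_simps\<close>)
  next
    case (eq_on f g)
    then show ?case by metis
  qed
  then obtain F R where FR: "\<And>h. h \<in> poly_funs W y \<Longrightarrow> F h \<in> poly_funs W' z \<and> R h \<in> poly_funs W y \<and>
      (\<forall>u\<in>A. h u = F h u + \<pi> * R h u)"
    by metis
  have "h \<in> series_funs W' z" if h: "h \<in> poly_funs W y" for h
  proof (rule series_funsI[of "\<lambda>k. F ((R ^^ k) h)"])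
    have Rk: "(R ^^ k) h \<in> poly_funs W y" for k by (induction k) (auto simp: h FR)
    then show "F ((R ^^ k) h) \<in> poly_funs W' z" for k using FR by blast
    fix u N assume u: "u \<in> A"
    have "h u = (\<Sum>k<N. \<pi> ^ k * F ((R ^^ k) h) u) + \<pi> ^ N * (R ^^ N) h u"
    proof (induction N)
      case (Suc N)
      have "(R ^^ N) h u = F ((R ^^ N) h) u + \<pi> * (R ^^ Suc N) h u"
        using FR[OF Rk[of N]] u by simp
      then show ?case using Suc.IH by (simp add: algebra_simps)
    qed simp
    then show "pi_cong \<pi> N (h u) (\<Sum>k<N. \<pi> ^ k * F ((R ^^ k) h) u)"
      using poly_funs_mem[OF Rk y u] by (intro pi_congI[of "(R ^^ N) h u"]) auto
  qed
  note poly = this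
  show ?thesis
  proof
    fix f assume "f \<in> series_funs W y"
    then obtain g where g: "\<forall>k. g k \<in> poly_funs W y"
      "\<forall>u N. u \<in> A \<longrightarrow> pi_cong \<pi> N (f u) (\<Sum>k<N. \<pi> ^ k * g k u)" by (rule series_funsE)
    show "f \<in> series_funs W' z"
      by (rule series_funs_series[of g]) (use poly g in blast)+
  qed
qed

subsection \<open>Coefficients\<close>

definition monomial_fun ::
    "'i set \<Rightarrow> ('i \<Rightarrow> 'p Qp_closure \<Rightarrow> 'p Qp_closure) \<Rightarrow> ('i \<Rightarrow>\<^sub>0 nat) \<Rightarrow> 'p Qp_closure \<Rightarrow> 'p Qp_closure" where
  "monomial_fun W y m u = (\<Prod>i\<in>W. y i u ^ Poly_Mapping.lookup m i)"

lemma monomial_fun_poly: "monomial_fun W y m \<in> poly_funs W y"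
proof -
  have "(\<lambda>u. \<Prod>i\<in>W. y i u ^ Poly_Mapping.lookup m i) \<in> poly_funs W y"
    by (intro poly_funs_prod poly_funs_power poly_funs.coord)
  then show ?thesis unfolding monomial_fun_def[abs_def] .
qed

lemma monomial_fun_mem: "maps_A W y \<Longrightarrow> u \<in> A \<Longrightarrow> monomial_fun W y m u \<in> A"
  by (rule poly_funs_mem[OF monomial_fun_poly])

lemma monomial_fun_add: "monomial_fun W y (m + m') u = monomial_fun W y m u * monomial_fun W y m' u"
  by (simp add: monomial_fun_def lookup_add power_add prod.distrib)

definition has_coeffs ::
    "'i set \<Rightarrow> ('i \<Rightarrow> 'p Qp_closure \<Rightarrow> 'p Qp_closure) \<Rightarrow> ('p Qp_closure \<Rightarrow> 'p Qp_closure) \<Rightarrow>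
     ('i \<Rightarrow>\<^sub>0 nat) set \<Rightarrow> (('i \<Rightarrow>\<^sub>0 nat) \<Rightarrow> 'p Qp_closure) \<Rightarrow> bool" where
  "has_coeffs W y f S c \<longleftrightarrow> finite S \<and> S \<subseteq> monomials W \<and> (\<forall>m. c m \<in> A) \<and> (\<forall>m. m \<notin> S \<longrightarrow> c m = 0) \<and>
     (\<forall>u\<in>A. f u = (\<Sum>m\<in>S. c m * monomial_fun W y m u))"

text \<open>This brings a finite sum with repeated monomials, as it arises from a product, into normal
  form.\<close>

lemma has_coeffs_collect:
  assumes "finite K" "\<And>x. x \<in> K \<Longrightarrow> h x \<in> monomials W" "\<And>x. x \<in> K \<Longrightarrow> d x \<in> A"
    and f: "\<And>u. u \<in> A \<Longrightarrow> f u = (\<Sum>x\<in>K. d x * monomial_fun W y (h x) u)"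
  shows "\<exists>S c. has_coeffs W y f S c"
proof -
  let ?c = "\<lambda>m. \<Sum>x\<in>{x \<in> K. h x = m}. d x"
  have "f u = (\<Sum>m\<in>h ` K. (\<Sum>x\<in>{x \<in> K. h x = m}. d x) * monomial_fun W y m u)" if "u \<in> A" for u
  proof -
    have "f u = (\<Sum>m\<in>h ` K. \<Sum>x\<in>{x \<in> K. h x = m}. d x * monomial_fun W y (h x) u)"
      using f[OF that] sum.image_gen[OF assms(1)] by (rule trans)
    also have "\<dots> = (\<Sum>m\<in>h ` K. \<Sum>x\<in>{x \<in> K. h x = m}. d x * monomial_fun W y m u)"
      by (intro sum.cong refl) auto
    finally show ?thesis by (simp add: sum_distrib_right)
  qed
  moreover have "?c m = 0" if "m \<notin> h ` K" for m
    by (rule sum.neutral) (use that in auto)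
  ultimately have "has_coeffs W y f (h ` K) ?c"
    using assms(1-3) by (auto simp: has_coeffs_def)
  then show ?thesis by blast
qed

lemma poly_funs_has_coeffs:
  assumes "f \<in> poly_funs W y" "finite W"
  shows "\<exists>S c. has_coeffs W y f S c"
  using assms(1)
proof induction
  case (const a)
  show ?case
    by (rule has_coeffs_collect[of "{()}" "\<lambda>_. 0" _ "\<lambda>_. a"])
      (auto simp: monomials_def monomial_fun_def const)
next
  case (coord i)
  have "y i u = monomial_fun W y (Poly_Mapping.single i 1) u" for u
  proof -
    have "monomial_fun W y (Poly_Mapping.single i 1) u = (\<Prod>j\<in>W. if j = i then y j u else 1)"
      unfolding monomial_fun_def by (rule prod.cong) (auto simp: lookup_single)
    then show ?thesis using coord assms(2) by simp
  qed
  then show ?case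
    by (intro has_coeffs_collect[of "{()}" "\<lambda>_. Poly_Mapping.single i 1" _ "\<lambda>_. 1"])
      (use coord in \<open>auto simp: monomials_def\<close>)
next
  case (add f g)
  obtain S c T d where f: "has_coeffs W y f S c" and g: "has_coeffs W y g T d"
    using add.IH by blast
  have "f u + g u = (\<Sum>m\<in>S \<union> T. (c m + d m) * monomial_fun W y m u)" if "u \<in> A" for u
  proof -
    have "f u = (\<Sum>m\<in>S \<union> T. c m * monomial_fun W y m u)"
      "g u = (\<Sum>m\<in>S \<union> T. d m * monomial_fun W y m u)"
      using f g that by (auto simp: has_coeffs_def intro!: sum.mono_neutral_left)
    then show ?thesis by (simp add: distrib_right sum.distrib)
  qed
  then have "has_coeffs W y (\<lambda>u. f u + g u) (S \<union> T) (\<lambda>m. c m + d m)"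
    using f g by (auto simp: has_coeffs_def)
  then show ?case by blast
next
  case (mult f g)
  obtain S c T d where f: "has_coeffs W y f S c" and g: "has_coeffs W y g T d"
    using mult.IH by blast
  show ?case
  proof (rule has_coeffs_collect[of "S \<times> T" "\<lambda>(m, m'). m + m'" _ "\<lambda>(m, m'). c m * d m'"])
    fix u assume "u \<in> A"
    then have "f u * g u = (\<Sum>m\<in>S. \<Sum>m'\<in>T. (c m * monomial_fun W y m u) * (d m' * monomial_fun W y m' u))"
      using f g by (simp add: has_coeffs_def sum_product)
    also have "\<dots> = (\<Sum>x\<in>S \<times> T. (case x of (m, m') \<Rightarrow> c m * d m')
        * monomial_fun W y (case x of (m, m') \<Rightarrow> m + m') u)"
      unfolding sum.cartesian_product
      by (intro sum.cong refl) (auto simp: monomial_fun_add ac_simps)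
    finally show "f u * g u = \<dots>" .
  next
    fix x assume "x \<in> S \<times> T"
    then obtain m m' where x: "x = (m, m')" "m \<in> S" "m' \<in> T" by auto
    then have "Poly_Mapping.keys m \<subseteq> W" "Poly_Mapping.keys m' \<subseteq> W"
      using f g by (auto simp: has_coeffs_def monomials_def)
    then show "(case x of (m, m') \<Rightarrow> m + m') \<in> monomials W"
      using Poly_Mapping.keys_add[of m m'] by (auto simp: x monomials_def)
  qed (use f g in \<open>auto simp: has_coeffs_def\<close>)
next
  case (eq_on f g)
  then obtain S c where "has_coeffs W y f S c" by blast
  then have "has_coeffs W y g S c" using eq_on.hyps(2) by (simp add: has_coeffs_def)
  then show ?case by blast
qed

text \<open>The terms of a restricted power series are grouped by the power of \<open>\<pi>\<close> known to divide their
  coefficients: the \<open>k\<close>-th group consists of the monomials that appear modulo \<open>\<pi> ^ (k + 1)\<close> but not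
  modulo \<open>\<pi> ^ k\<close>.\<close>

lemma has_value_series_funs:
  assumes G: "G \<in> restricted_power_series \<pi> W" and W: "maps_A W y"
    and f: "\<And>u. u \<in> A \<Longrightarrow> has_value \<pi> W G (\<lambda>i. y i u) (f u)"
  shows "f \<in> series_funs W y"
proof -
  define T where "T N = {m \<in> monomials W. \<not> pi_cong \<pi> N (G m) 0}" for N
  have fin: "finite (T N)" and sub: "T N \<subseteq> monomials W" for N
    using G by (auto simp: T_def restricted_power_series_def)
  have GA: "G m \<in> A" if "m \<in> monomials W" for m
    using G that by (auto simp: restricted_power_series_def)
  have T0: "T 0 = {}" using GA by (auto simp: T_def pi_cong_0_iff)
  have mono: "T N \<subseteq> T (Suc N)" for N
    using pi_cong_mono[of "Suc N" _ 0 N] by (auto simp: T_def)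
  \<comment> \<open>Outside \<open>T k\<close> the coefficient is divisible by \<open>\<pi> ^ k\<close>, so the quotient lies in \<open>A\<close>.\<close>
  define g where "g k u = (\<Sum>m\<in>T (Suc k) - T k. G m / \<pi> ^ k * monomial_fun W y m u)" for k u
  have sum_g: "(\<Sum>k<N. \<pi> ^ k * g k u) = (\<Sum>m\<in>T N. G m * monomial_fun W y m u)" for N u
  proof (induction N)
    case (Suc N)
    have "\<pi> ^ N * g N u = (\<Sum>m\<in>T (Suc N) - T N. G m * monomial_fun W y m u)"
      using pi_nonzero by (simp add: g_def sum_distrib_left)
    then show ?case
      using Suc.IH sum.subset_diff[OF mono fin, of "\<lambda>m. G m * monomial_fun W y m u" N]
      by (simp add: add.commute)
  qed (simp add: T0)
  show ?thesis
  proof (rule series_funsI[of g])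
    show "g k \<in> poly_funs W y" for k
    proof -
      have "G m / \<pi> ^ k \<in> A" if "m \<in> T (Suc k) - T k" for m
      proof -
        have "pi_cong \<pi> k (G m) 0" using that by (auto simp: T_def)
        then obtain c where "c \<in> A" "G m = 0 + \<pi> ^ k * c" by (rule pi_congE)
        then show ?thesis using pi_nonzero by simp
      qed
      then have "(\<lambda>u. \<Sum>m\<in>T (Suc k) - T k. G m / \<pi> ^ k * monomial_fun W y m u) \<in> poly_funs W y"
        by (intro poly_funs_sum poly_funs_scale monomial_fun_poly)
      then show ?thesis unfolding g_def[abs_def] .
    qed
    fix u N assume u: "u \<in> A"
    obtain K where K: "finite K" "K \<subseteq> monomials W"
      "\<And>Y. finite Y \<Longrightarrow> K \<subseteq> Y \<Longrightarrow> Y \<subseteq> monomials W \<Longrightarrow>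
        pi_cong \<pi> N (\<Sum>m\<in>Y. G m * monomial_fun W y m u) (f u)"
      using f[OF u] unfolding has_value_def eventually_finite_subsets_at_top monomial_fun_def
      by meson
    have "pi_cong \<pi> N (f u) (\<Sum>m\<in>K \<union> T N. G m * monomial_fun W y m u)"
      by (rule pi_cong_sym, rule K(3)) (use K(1,2) fin sub in auto)
    also have "(\<Sum>m\<in>K \<union> T N. G m * monomial_fun W y m u)
        = (\<Sum>m\<in>K - T N. G m * monomial_fun W y m u) + (\<Sum>m\<in>T N. G m * monomial_fun W y m u)"
      using sum.subset_diff[of "T N" "K \<union> T N"] K(1) fin by (simp add: Un_Diff)
    also have "pi_cong \<pi> N \<dots> ((\<Sum>m\<in>K - T N. 0) + (\<Sum>m\<in>T N. G m * monomial_fun W y m u))"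
    proof (intro pi_cong_add pi_cong_refl pi_cong_sum)
      fix m assume "m \<in> K - T N"
      then have "pi_cong \<pi> N (G m) 0" using K(2) by (auto simp: T_def)
      then have "pi_cong \<pi> N (G m * monomial_fun W y m u) (0 * monomial_fun W y m u)"
        by (rule pi_cong_mult_right) (rule monomial_fun_mem[OF W u])
      then show "pi_cong \<pi> N (G m * monomial_fun W y m u) 0" by simp
    qed
    finally show "pi_cong \<pi> N (f u) (\<Sum>k<N. \<pi> ^ k * g k u)" by (simp add: sum_g)
  qed
qed

text \<open>The coefficient of a fixed monomial in \<open>\<Sum>k. \<pi> ^ k g k\<close> is a series in \<open>A\<close> whose
  \<open>k\<close>-th term is divisible by \<open>\<pi> ^ k\<close>, so completeness of \<open>A\<close> provides its sum.\<close>

lemma series_funs_has_value: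
  assumes f: "f \<in> series_funs W y" and W: "maps_A W y" "finite W"
  shows "\<exists>G\<in>restricted_power_series \<pi> W. \<forall>u\<in>A. has_value \<pi> W G (\<lambda>i. y i u) (f u)"
proof -
  obtain g where g: "\<forall>k. g k \<in> poly_funs W y"
    "\<forall>u N. u \<in> A \<longrightarrow> pi_cong \<pi> N (f u) (\<Sum>k<N. \<pi> ^ k * g k u)" using f by (rule series_funsE)
  have "\<exists>S c. has_coeffs W y (g k) S c" for k
    using poly_funs_has_coeffs[OF spec[OF g(1)] W(2)] .
  then obtain S c where Sc: "\<And>k. has_coeffs W y (g k) (S k) (c k)" by metis
  have "\<exists>s\<in>A. \<forall>N. pi_cong \<pi> N s (\<Sum>k<N. \<pi> ^ k * c k m)" for m
    by (rule A_complete) (use Sc in \<open>simp add: has_coeffs_def\<close>)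
  then obtain G where G: "\<And>m. G m \<in> A" "\<And>m N. pi_cong \<pi> N (G m) (\<Sum>k<N. \<pi> ^ k * c k m)"
    by metis
  have "{m \<in> monomials W. \<not> pi_cong \<pi> N (G m) 0} \<subseteq> (\<Union>k<N. S k)" for N
  proof
    fix m assume m: "m \<in> {m \<in> monomials W. \<not> pi_cong \<pi> N (G m) 0}"
    show "m \<in> (\<Union>k<N. S k)"
    proof (rule ccontr)
      assume "m \<notin> (\<Union>k<N. S k)"
      then have "(\<Sum>k<N. \<pi> ^ k * c k m) = 0"
        using Sc by (intro sum.neutral) (auto simp: has_coeffs_def)
      then show False using m G(2)[of N m] by simp
    qed
  qed
  moreover have fin: "finite (\<Union>k<N. S k)" for N using Sc by (auto simp: has_coeffs_def)
  ultimately have "finite {m \<in> monomials W. \<not> pi_cong \<pi> N (G m) 0}" for N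
    by (rule finite_subset)
  then have "G \<in> restricted_power_series \<pi> W"
    using G(1) by (auto simp: restricted_power_series_def)
  moreover have "has_value \<pi> W G (\<lambda>i. y i u) (f u)" if u: "u \<in> A" for u
    unfolding has_value_def eventually_finite_subsets_at_top
  proof (intro allI exI conjI impI)
    fix N
    show "finite (\<Union>k<N. S k)" by (rule fin)
    show "(\<Union>k<N. S k) \<subseteq> monomials W" using Sc unfolding has_coeffs_def by blast
    fix F assume F: "finite F \<and> (\<Union>k<N. S k) \<subseteq> F \<and> F \<subseteq> monomials W"
    have "pi_cong \<pi> N (\<Sum>m\<in>F. G m * monomial_fun W y m u)
        (\<Sum>m\<in>F. (\<Sum>k<N. \<pi> ^ k * c k m) * monomial_fun W y m u)"
      by (intro pi_cong_sum pi_cong_mult_right G(2) monomial_fun_mem[OF W(1) u])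
    also have "(\<Sum>m\<in>F. (\<Sum>k<N. \<pi> ^ k * c k m) * monomial_fun W y m u)
        = (\<Sum>k<N. \<pi> ^ k * (\<Sum>m\<in>F. c k m * monomial_fun W y m u))"
      unfolding sum_distrib_left sum_distrib_right mult.assoc by (rule sum.swap)
    also have "\<dots> = (\<Sum>k<N. \<pi> ^ k * g k u)"
    proof (intro sum.cong refl arg_cong2[of _ _ _ _ "(*)"])
      fix k assume "k \<in> {..<N}"
      then have "(\<Sum>m\<in>F. c k m * monomial_fun W y m u) = (\<Sum>m\<in>S k. c k m * monomial_fun W y m u)"
        using F Sc by (intro sum.mono_neutral_right) (auto simp: has_coeffs_def)
      then show "(\<Sum>m\<in>F. c k m * monomial_fun W y m u) = g k u"
        using Sc[of k] u by (simp add: has_coeffs_def)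
    qed
    also have "pi_cong \<pi> N \<dots> (f u)" using g(2) u by (blast intro: pi_cong_sym)
    finally show "pi_cong \<pi> N (\<Sum>m\<in>F. G m * (\<Prod>i\<in>W. y i u ^ Poly_Mapping.lookup m i)) (f u)"
      by (simp add: monomial_fun_def)
  qed
  ultimately show ?thesis by blast
qed

subsection \<open>Indicator functions of residue classes\<close>

text \<open>The substitution \<open>a \<mapsto> 3 a\<^sup>2 - 2 a\<^sup>3\<close> is Newton's iteration for \<open>a\<^sup>2 = a\<close>.\<close>

lemma idempotent_lift_identities:
  fixes a :: "'b::comm_ring_1"
  shows "(3 * a ^ 2 - 2 * a ^ 3) ^ 2 - (3 * a ^ 2 - 2 * a ^ 3) = (a ^ 2 - a) ^ 2 * (4 * (a ^ 2 - a) - 3)"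
    and "3 * a ^ 2 - 2 * a ^ 3 = a + (a ^ 2 - a) * (1 - 2 * a)"
    and "3 * a ^ 2 - 2 * a ^ 3 - 1 = - ((a - 1) ^ 2 * (1 + 2 * a))"
    and "3 * a ^ 2 - 2 * a ^ 3 = a ^ 2 * (3 - 2 * a)"
  by (simp_all add: power2_eq_square power3_eq_cube algebra_simps)

text \<open>The values of \<open>1 - x ^ (p - 1)\<close> are congruent to \<open>1\<close> modulo \<open>\<pi>\<close> where \<open>x\<close> is divisible by \<open>\<pi>\<close>,
  and to \<open>0\<close> where \<open>x\<close> is a unit modulo \<open>\<pi>\<close>. Since \<open>x - x ^ p\<close> is \<open>\<pi>\<close> times a polynomial function
  \<open>g\<close>, this function is idempotent modulo \<open>\<pi>\<close> times a polynomial function, and Newton's iteration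
  lifts it to an idempotent while keeping each correction a polynomial multiple of a power of \<open>\<pi>\<close>.
  The limit is therefore the exact indicator of the class \<open>x \<equiv> 0\<close> and belongs to
  \<open>series_funs\<close>.\<close>

lemma residue_indicator:
  assumes W: "maps_A W y" and x: "x \<in> poly_funs W y" and g: "g \<in> poly_funs W y"
    and xg: "\<And>u. u \<in> A \<Longrightarrow> x u - x u ^ CARD('p) = \<pi> * g u"
  shows "\<exists>\<chi> \<in> series_funs W y. \<forall>u\<in>A.
    (pi_cong \<pi> 1 (x u) 0 \<longrightarrow> (\<forall>N. pi_cong \<pi> N (\<chi> u) 1)) \<and>
    ((\<exists>b\<in>A. pi_cong \<pi> 1 (x u * b) 1) \<longrightarrow> (\<forall>N. pi_cong \<pi> N (\<chi> u) 0))"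
proof -
  define q where "q = CARD('p) - 2"
  have q: "CARD('p) = Suc (Suc q)"
    using prime_ge_2_nat[OF prime_card[where 'a='p]] unfolding q_def by linarith
  define \<epsilon> where "\<epsilon> = rec_nat (\<lambda>u. 1 - x u ^ Suc q) (\<lambda>_ f u. 3 * f u ^ 2 - 2 * f u ^ 3)"
  have \<epsilon>0: "\<epsilon> 0 u = 1 - x u ^ Suc q" and \<epsilon>Suc: "\<epsilon> (Suc k) u = 3 * \<epsilon> k u ^ 2 - 2 * \<epsilon> k u ^ 3" for k u
    by (simp_all add: \<epsilon>_def)
  have \<epsilon>_poly: "\<epsilon> k \<in> poly_funs W y" for k
  proof (induction k)
    case 0
    show ?case
      by (rule poly_funs.eq_on[OF poly_funs_diff[OF poly_funs.const[OF A_1] poly_funs_power[OF x]] \<epsilon>0])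
  next
    case (Suc k)
    show ?case
      by (rule poly_funs.eq_on[OF poly_funs_diff[OF poly_funs_scale[OF A_numeral poly_funs_power[OF Suc]]
              poly_funs_scale[OF A_numeral poly_funs_power[OF Suc]]] \<epsilon>Suc])
  qed
  note \<epsilon>_mem = poly_funs_mem[OF \<epsilon>_poly W]
  have "\<exists>h \<in> poly_funs W y. \<forall>u\<in>A. \<epsilon> k u ^ 2 - \<epsilon> k u = \<pi> ^ Suc k * h u" for k
  proof (induction k)
    case 0
    have "\<epsilon> 0 u ^ 2 - \<epsilon> 0 u = \<pi> ^ Suc 0 * (- 1 * (x u ^ q * g u))" if "u \<in> A" for u
    proof -
      have "\<epsilon> 0 u ^ 2 - \<epsilon> 0 u = - (x u ^ q * (x u - x u ^ CARD('p)))"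
        by (simp add: \<epsilon>0 q power2_eq_square algebra_simps)
      then show ?thesis by (simp add: xg[OF that])
    qed
    moreover have "(\<lambda>u. - 1 * (x u ^ q * g u)) \<in> poly_funs W y"
      by (intro poly_funs_scale poly_funs.mult poly_funs_power x g) auto
    ultimately show ?case by (intro bexI[of _ "\<lambda>u. - 1 * (x u ^ q * g u)"] ballI)
  next
    case (Suc k)
    then obtain h where h: "h \<in> poly_funs W y" "\<And>u. u \<in> A \<Longrightarrow> \<epsilon> k u ^ 2 - \<epsilon> k u = \<pi> ^ Suc k * h u"
      by blast
    have "\<epsilon> (Suc k) u ^ 2 - \<epsilon> (Suc k) u
        = \<pi> ^ Suc (Suc k) * (\<pi> ^ k * h u ^ 2 * (4 * (\<epsilon> k u ^ 2 - \<epsilon> k u) - 3))" if "u \<in> A" for u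
    proof -
      have "\<epsilon> (Suc k) u ^ 2 - \<epsilon> (Suc k) u = (\<epsilon> k u ^ 2 - \<epsilon> k u) ^ 2 * (4 * (\<epsilon> k u ^ 2 - \<epsilon> k u) - 3)"
        unfolding \<epsilon>Suc by (rule idempotent_lift_identities)
      also have "(\<epsilon> k u ^ 2 - \<epsilon> k u) ^ 2 = \<pi> ^ Suc (Suc k) * (\<pi> ^ k * h u ^ 2)"
        unfolding h(2)[OF that] by (simp add: power2_eq_square algebra_simps)
      finally show ?thesis by (simp only: mult.assoc)
    qed
    moreover have "(\<lambda>u. \<pi> ^ k * h u ^ 2 * (4 * (\<epsilon> k u ^ 2 - \<epsilon> k u) - 3)) \<in> poly_funs W y"
      by (intro poly_funs.mult poly_funs_diff poly_funs_scale poly_funs_power poly_funs.const h \<epsilon>_poly) auto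
    ultimately show ?case
      by (intro bexI[of _ "\<lambda>u. \<pi> ^ k * h u ^ 2 * (4 * (\<epsilon> k u ^ 2 - \<epsilon> k u) - 3)"] ballI)
  qed
  then obtain h where h: "\<And>k. h k \<in> poly_funs W y"
    "\<And>k u. u \<in> A \<Longrightarrow> \<epsilon> k u ^ 2 - \<epsilon> k u = \<pi> ^ Suc k * h k u"
    by metis
  \<comment> \<open>The increments of the iteration, divided by \<open>\<pi> ^ k\<close>.\<close>
  define t where "t k = (case k of 0 \<Rightarrow> \<epsilon> 0 | Suc k \<Rightarrow> (\<lambda>u. (1 - 2 * \<epsilon> k u) * h k u))" for k
  have "t k \<in> poly_funs W y" for k
  proof (cases k)
    case (Suc j)
    have "(\<lambda>u. (1 - 2 * \<epsilon> j u) * h j u) \<in> poly_funs W y"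
      by (intro poly_funs.mult poly_funs_diff poly_funs_scale poly_funs.const h \<epsilon>_poly) auto
    then show ?thesis by (simp add: t_def Suc)
  qed (simp add: t_def \<epsilon>_poly)
  then obtain \<chi> where \<chi>: "\<chi> \<in> series_funs W y"
    "\<forall>u\<in>A. \<forall>N. pi_cong \<pi> N (\<chi> u) (\<Sum>k<N. \<pi> ^ k * t k u)"
    using series_funs_exists_sum[of t, OF _ W] by blast
  have sum_t: "(\<Sum>k<Suc N. \<pi> ^ k * t k u) = \<epsilon> N u" if "u \<in> A" for N u
  proof (induction N)
    case (Suc N)
    have "\<epsilon> (Suc N) u = \<epsilon> N u + (\<epsilon> N u ^ 2 - \<epsilon> N u) * (1 - 2 * \<epsilon> N u)"
      unfolding \<epsilon>Suc by (rule idempotent_lift_identities)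
    also have "\<dots> = \<epsilon> N u + \<pi> ^ Suc N * t (Suc N) u"
      unfolding h(2)[OF that] by (simp add: t_def mult_ac)
    finally show ?case using Suc.IH by simp
  qed (simp add: t_def)
  have \<chi>\<epsilon>: "pi_cong \<pi> N (\<chi> u) c" if "u \<in> A" and c: "pi_cong \<pi> (Suc N) (\<epsilon> N u) c" for N u c
  proof -
    have "pi_cong \<pi> (Suc N) (\<chi> u) (\<epsilon> N u)"
      using \<chi>(2) \<open>u \<in> A\<close> sum_t[OF \<open>u \<in> A\<close>, of N] by metis
    then have "pi_cong \<pi> (Suc N) (\<chi> u) c" using c by (rule pi_cong_trans)
    then show ?thesis by (rule pi_cong_mono) simp
  qed
  have "pi_cong \<pi> N (\<chi> u) 1" if u: "u \<in> A" and x0: "pi_cong \<pi> 1 (x u) 0" for u N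
  proof (rule \<chi>\<epsilon>[OF u])
    show "pi_cong \<pi> (Suc N) (\<epsilon> N u) 1"
    proof (induction N)
      case 0
      have "pi_cong \<pi> 1 (x u * x u ^ q) (0 * x u ^ q)"
        using x0 by (rule pi_cong_mult_right) (intro A_power poly_funs_mem[OF x W u])
      then have "pi_cong \<pi> 1 (1 - x u * x u ^ q) (1 - 0 * x u ^ q)"
        by (intro pi_cong_diff pi_cong_refl)
      then show ?case by (simp add: \<epsilon>0)
    next
      case (Suc N)
      then obtain c where c: "c \<in> A" "\<epsilon> N u = 1 + \<pi> ^ Suc N * c" by (rule pi_congE)
      have "\<epsilon> (Suc N) u - 1 = - ((\<epsilon> N u - 1) ^ 2 * (1 + 2 * \<epsilon> N u))"
        unfolding \<epsilon>Suc by (rule idempotent_lift_identities)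
      also have "(\<epsilon> N u - 1) ^ 2 = \<pi> ^ Suc (Suc N) * (\<pi> ^ N * c ^ 2)"
        by (simp add: c(2) power2_eq_square algebra_simps)
      finally have "\<epsilon> (Suc N) u - 1 = \<pi> ^ Suc (Suc N) * (- (\<pi> ^ N * c ^ 2 * (1 + 2 * \<epsilon> N u)))"
        by (simp only: mult.assoc mult_minus_right)
      then show ?case by (rule pi_congI[rotated]) (use c(1) \<epsilon>_mem[OF u] in auto)
    qed
  qed
  moreover have "pi_cong \<pi> N (\<chi> u) 0"
    if u: "u \<in> A" and b: "b \<in> A" "pi_cong \<pi> 1 (x u * b) 1" for u b N
  proof (rule \<chi>\<epsilon>[OF u])
    show "pi_cong \<pi> (Suc N) (\<epsilon> N u) 0"
    proof (induction N)
      case 0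
      have "pi_cong \<pi> 1 (\<epsilon> 0 u * 1) (\<epsilon> 0 u * (x u * b))"
        by (intro pi_cong_mult_left pi_cong_sym[OF b(2)] \<epsilon>_mem[OF u])
      also have "\<epsilon> 0 u * (x u * b) = (x u - x u ^ CARD('p)) * b"
        by (simp add: \<epsilon>0 q algebra_simps)
      also have "\<dots> = \<pi> * (g u * b)" by (simp add: xg[OF u])
      also have "pi_cong \<pi> 1 \<dots> 0"
        using poly_funs_mem[OF g W u] b(1) by (intro pi_congI[of "g u * b"]) auto
      finally show ?case by simp
    next
      case (Suc N)
      then obtain c where c: "c \<in> A" "\<epsilon> N u = 0 + \<pi> ^ Suc N * c" by (rule pi_congE)
      have "\<epsilon> (Suc N) u = \<epsilon> N u ^ 2 * (3 - 2 * \<epsilon> N u)"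
        unfolding \<epsilon>Suc by (rule idempotent_lift_identities)
      also have "\<epsilon> N u ^ 2 = \<pi> ^ Suc (Suc N) * (\<pi> ^ N * c ^ 2)"
        by (simp add: c(2) power2_eq_square algebra_simps)
      finally have "\<epsilon> (Suc N) u - 0 = \<pi> ^ Suc (Suc N) * (\<pi> ^ N * c ^ 2 * (3 - 2 * \<epsilon> N u))"
        by (simp only: mult.assoc diff_0_right)
      then show ?case by (rule pi_congI[rotated]) (use c(1) \<epsilon>_mem[OF u] in auto)
    qed
  qed
  ultimately show ?thesis using \<chi>(1) by (intro bexI[of _ \<chi>] ballI conjI impI allI) auto
qed

section \<open>Lifts of Frobenius and their derivations\<close>

lemma prime_P: "prime CARD('p)"
  by (rule prime_card)

context
  fixes \<psi> assumes \<psi>: "frobenius_lift \<pi> \<psi>"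
begin

lemma frobenius_lift_mem: "a \<in> A \<Longrightarrow> \<psi> a \<in> A"
  and frobenius_lift_1: "\<psi> 1 = 1"
  and frobenius_lift_add: "a \<in> A \<Longrightarrow> b \<in> A \<Longrightarrow> \<psi> (a + b) = \<psi> a + \<psi> b"
  and frobenius_lift_mult: "a \<in> A \<Longrightarrow> b \<in> A \<Longrightarrow> \<psi> (a * b) = \<psi> a * \<psi> b"
  and frobenius_lift_cong: "a \<in> A \<Longrightarrow> pi_cong \<pi> 1 (\<psi> a) (a ^ CARD('p))"
  using \<psi> by (auto simp: frobenius_lift_def)

lemma frobenius_lift_0: "\<psi> 0 = 0"
proof -
  have "\<psi> 0 + \<psi> 0 = \<psi> 0 + 0"
    using frobenius_lift_add[OF A_0 A_0] by (simp only: add_0_right)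
  then show ?thesis by (rule add_left_imp_eq)
qed

lemma frobenius_lift_of_nat: "\<psi> (of_nat k) = of_nat k"
  by (induction k) (simp_all add: frobenius_lift_0 frobenius_lift_1 frobenius_lift_add)

lemma frobenius_lift_power: "a \<in> A \<Longrightarrow> \<psi> (a ^ k) = \<psi> a ^ k"
  by (induction k) (simp_all add: frobenius_lift_1 frobenius_lift_mult)

lemma pi_derivation_mem:
  assumes "a \<in> A" shows "pi_derivation \<pi> \<psi> a \<in> A"
proof -
  obtain c where "c \<in> A" "\<psi> a = a ^ CARD('p) + \<pi> ^ 1 * c"
    using frobenius_lift_cong[OF assms] by (rule pi_congE)
  then show ?thesis using pi_nonzero by (simp add: pi_derivation_def)
qed

lemma frobenius_lift_eq: "\<psi> a = a ^ CARD('p) + \<pi> * pi_derivation \<pi> \<psi> a"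
  using pi_nonzero by (simp add: pi_derivation_def)

text \<open>Write \<open>p = \<pi> ^ e w\<close> with a unit \<open>w\<close>. Since \<open>\<psi>\<close> fixes \<open>p\<close>, also \<open>p = (\<psi> \<pi>) ^ e \<psi> w\<close>, so
  \<open>w = (\<psi> \<pi> / \<pi>) ^ e \<psi> w\<close> and \<open>\<psi> \<pi> / \<pi>\<close> divides a unit.\<close>

lemma frobenius_lift_pi:
  obtains c c' where "c \<in> A" "c' \<in> A" "c * c' = 1" "\<psi> \<pi> = \<pi> * c"
proof -
  define c where "c = \<pi> ^ (CARD('p) - 1) + pi_derivation \<pi> \<psi> \<pi>"
  have "\<pi> ^ CARD('p) = \<pi> * \<pi> ^ (CARD('p) - 1)"
    using power_minus_mult[OF prime_gt_0_nat[OF prime_P], of \<pi>] by (simp only: mult.commute)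
  then have c: "c \<in> A" "\<psi> \<pi> = \<pi> * c"
    using frobenius_lift_eq[of \<pi>] pi_derivation_mem[OF A_pi]
    by (auto simp: c_def distrib_left)
  obtain w w' where w: "w \<in> A" "w' \<in> A" "w * w' = 1" "P = \<pi> ^ e * w"
    by (rule P_associated_pi_power)
  have "P = \<psi> (\<pi> ^ e * w)" using w(4) frobenius_lift_of_nat[of "CARD('p)"] by simp
  also have "\<dots> = (\<pi> * c) ^ e * \<psi> w"
    using w(1) by (simp add: frobenius_lift_mult frobenius_lift_power c(2))
  finally have "\<pi> ^ e * w = \<pi> ^ e * (c ^ e * \<psi> w)"
    using w(4) by (simp add: power_mult_distrib mult.assoc)
  then have "w = c ^ e * \<psi> w" using pi_nonzero by simp
  also have "c ^ e = c * c ^ (e - 1)"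
    using power_minus_mult[OF e_pos, of c] by (simp only: mult.commute)
  finally have eq: "w = c * c ^ (e - 1) * \<psi> w" .
  have "c * (c ^ (e - 1) * \<psi> w * w') = (c * c ^ (e - 1) * \<psi> w) * w'" by (simp only: mult.assoc)
  also have "\<dots> = 1" unfolding eq[symmetric] by (rule w(3))
  finally have "c * (c ^ (e - 1) * \<psi> w * w') = 1" .
  then show thesis
    using c w frobenius_lift_mem[OF w(1)] by (intro that[of c "c ^ (e - 1) * \<psi> w * w'"]) auto
qed

end

text \<open>The inner binomial coefficients are divisible by \<open>p\<close> and hence by \<open>\<pi>\<close>.\<close>

lemma power_p_binomial:
  assumes "b \<in> A"
  shows "\<exists>d. (\<forall>j. d j \<in> A) \<and> (\<forall>w. (b + w) ^ CARD('p)
    = b ^ CARD('p) + w ^ CARD('p) + \<pi> * (\<Sum>j\<in>{1..<CARD('p)}. d j * w ^ j))"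
proof -
  let ?p = "CARD('p)"
  obtain t where t: "t \<in> A" "P = \<pi> * t" by (rule P_in_pi_A)
  define d where "d j = t * of_nat ((?p choose j) div ?p) * b ^ (?p - j)" for j
  have d: "of_nat (?p choose j) * w ^ j * b ^ (?p - j) = \<pi> * (d j * w ^ j)"
    if "j \<in> {1..<?p}" for j w
  proof -
    have "?p dvd (?p choose j)" using that by (intro dvd_choose_prime prime_P) auto
    then have "(of_nat (?p choose j) :: 'p Qp_closure) = P * of_nat ((?p choose j) div ?p)"
      by (metis dvd_mult_div_cancel of_nat_mult)
    then show ?thesis by (simp add: d_def t(2) mult_ac)
  qed
  have p: "0 < ?p" using prime_P by (rule prime_gt_0_nat)
  have "(b + w) ^ ?p = b ^ ?p + w ^ ?p + \<pi> * (\<Sum>j\<in>{1..<?p}. d j * w ^ j)" for w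
  proof -
    have "(b + w) ^ ?p = (\<Sum>j\<le>?p. of_nat (?p choose j) * w ^ j * b ^ (?p - j))"
      using binomial_ring[of w b ?p] by (simp add: add.commute)
    also have "{..?p} = insert 0 (insert ?p {1..<?p})" using p by auto
    also have "(\<Sum>j\<in>\<dots>. of_nat (?p choose j) * w ^ j * b ^ (?p - j))
        = b ^ ?p + (w ^ ?p + (\<Sum>j\<in>{1..<?p}. of_nat (?p choose j) * w ^ j * b ^ (?p - j)))"
      using p by simp
    also have "(\<Sum>j\<in>{1..<?p}. of_nat (?p choose j) * w ^ j * b ^ (?p - j))
        = \<pi> * (\<Sum>j\<in>{1..<?p}. d j * w ^ j)"
      unfolding sum_distrib_left by (intro sum.cong refl d)
    finally show ?thesis by (simp only: add.assoc)
  qed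
  moreover have "d j \<in> A" for j using assms t by (auto simp: d_def)
  ultimately show ?thesis by blast
qed

text \<open>All terms of the binomial expansion involving \<open>w\<close> gain a further factor \<open>\<pi>\<close>: the middle ones
  from \<open>p\<close>, the last one since \<open>(m + 1) p \<ge> m + 2\<close>.\<close>

lemma power_p_perturbation:
  assumes "b \<in> A" "w \<in> poly_funs W y"
  shows "\<exists>R \<in> poly_funs W y. \<forall>u.
    (b + \<pi> ^ Suc m * w u) ^ CARD('p) = b ^ CARD('p) + \<pi> ^ Suc (Suc m) * R u"
proof -
  let ?p = "CARD('p)"
  obtain d where d: "\<forall>j. d j \<in> A"
    "\<forall>w. (b + w) ^ ?p = b ^ ?p + w ^ ?p + \<pi> * (\<Sum>j\<in>{1..<?p}. d j * w ^ j)"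
    using power_p_binomial[OF assms(1)] by blast
  define R where "R u = \<pi> ^ (Suc m * ?p - Suc (Suc m)) * w u ^ ?p
    + (\<Sum>j\<in>{1..<?p}. (d j * \<pi> ^ (Suc m * (j - 1))) * w u ^ j)" for u
  have "Suc m * 2 \<le> Suc m * ?p" using prime_ge_2_nat[OF prime_P] by (rule mult_le_mono2)
  then have p: "Suc m * ?p = Suc (Suc m) + (Suc m * ?p - Suc (Suc m))" by simp
  have "(b + \<pi> ^ Suc m * w u) ^ ?p = b ^ ?p + \<pi> ^ Suc (Suc m) * R u" for u
  proof -
    have last: "(\<pi> ^ Suc m * w u) ^ ?p
        = \<pi> ^ Suc (Suc m) * (\<pi> ^ (Suc m * ?p - Suc (Suc m)) * w u ^ ?p)"
      unfolding power_mult_distrib power_mult[symmetric]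
      by (subst p) (simp only: power_add mult.assoc)
    have middle: "\<pi> * (d j * (\<pi> ^ Suc m * w u) ^ j)
        = \<pi> ^ Suc (Suc m) * ((d j * \<pi> ^ (Suc m * (j - 1))) * w u ^ j)" if "j \<in> {1..<?p}" for j
    proof -
      have "Suc m * j = Suc m + Suc m * (j - 1)"
        using that by (cases j) auto
      then have "(\<pi> ^ Suc m) ^ j = \<pi> ^ Suc m * \<pi> ^ (Suc m * (j - 1))"
        by (simp only: power_mult[symmetric] power_add[symmetric])
      then show ?thesis
        by (simp only: power_mult_distrib power_Suc[of \<pi> "Suc m"] mult_ac)
    qed
    have "\<pi> * (\<Sum>j\<in>{1..<?p}. d j * (\<pi> ^ Suc m * w u) ^ j)
        = \<pi> ^ Suc (Suc m) * (\<Sum>j\<in>{1..<?p}. (d j * \<pi> ^ (Suc m * (j - 1))) * w u ^ j)"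
      unfolding sum_distrib_left by (intro sum.cong refl middle)
    then show ?thesis
      unfolding spec[OF d(2)] last R_def by (simp only: distrib_left add.assoc)
  qed
  moreover have "R \<in> poly_funs W y"
  proof -
    have "(\<lambda>u. \<pi> ^ (Suc m * ?p - Suc (Suc m)) * w u ^ ?p
        + (\<Sum>j\<in>{1..<?p}. (d j * \<pi> ^ (Suc m * (j - 1))) * w u ^ j)) \<in> poly_funs W y"
      by (intro poly_funs.add poly_funs_sum poly_funs_scale poly_funs_power assms(2)
          A_power A_mult A_pi spec[OF d(1)])
    then show ?thesis unfolding R_def[abs_def] .
  qed
  ultimately show ?thesis by blast
qed

end

lemma word_comp_append: "word_comp h (\<mu> @ \<nu>) = word_comp h \<mu> \<circ> word_comp h \<nu>"
  by (induction \<mu>) (simp_all add: o_assoc)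

lemma finite_words: "finite (words n r)"
  using finite_lists_length_le[of "{1..n}" r]
  by (simp add: words_def in_lists_conv_set subset_iff Ball_def)

lemma words_mono: "r \<le> s \<Longrightarrow> words n r \<subseteq> words n s"
  by (auto simp: words_def)

locale frobenius_family = eisenstein_root \<pi> E
  for \<pi> :: "'p::prime_card Qp_closure" and E :: "'p padic_int poly" +
  fixes \<phi> :: "nat \<Rightarrow> 'p Qp_closure \<Rightarrow> 'p Qp_closure" and n :: nat
  assumes frobenius: "\<And>i. i \<in> {1..n} \<Longrightarrow> frobenius_lift \<pi> (\<phi> i)"
begin

abbreviation \<phi>w where "\<phi>w \<equiv> word_comp \<phi>"

abbreviation \<delta>w where "\<delta>w \<equiv> word_comp (\<lambda>i. pi_derivation \<pi> (\<phi> i))"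

lemma \<phi>w_mem: "\<mu> \<in> lists {1..n} \<Longrightarrow> a \<in> A \<Longrightarrow> \<phi>w \<mu> a \<in> A"
  by (induction \<mu>) (auto intro: frobenius_lift_mem[OF frobenius])

lemma \<delta>w_mem: "\<mu> \<in> lists {1..n} \<Longrightarrow> a \<in> A \<Longrightarrow> \<delta>w \<mu> a \<in> A"
  by (induction \<mu>) (auto intro: pi_derivation_mem[OF frobenius])

lemma maps_A_\<phi>w: "maps_A (words n r) \<phi>w" and maps_A_\<delta>w: "maps_A (words n r) \<delta>w"
  by (auto simp: maps_A_def words_def intro: \<phi>w_mem \<delta>w_mem)

lemma poly_funs_words_mono:
  assumes "r \<le> s" shows "poly_funs (words n r) y \<subseteq> poly_funs (words n s) y"
  by (rule poly_funs_subset) (use words_mono[OF assms] in \<open>auto intro: poly_funs.coord\<close>)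

lemma \<phi>_poly_funs:
  assumes "i \<in> {1..n}" "f \<in> poly_funs (words n s) \<phi>w"
  shows "(\<lambda>u. \<phi> i (f u)) \<in> poly_funs (words n (Suc s)) \<phi>w"
proof (rule poly_funs_hom[OF assms(2) maps_A_\<phi>w])
  fix \<mu> assume "\<mu> \<in> words n s"
  then have "i # \<mu> \<in> words n (Suc s)" using assms(1) by (auto simp: words_def)
  then have "\<phi>w (i # \<mu>) \<in> poly_funs (words n (Suc s)) \<phi>w" by (rule poly_funs.coord)
  then show "(\<lambda>u. \<phi> i (\<phi>w \<mu> u)) \<in> poly_funs (words n (Suc s)) \<phi>w" by (simp add: comp_def)
qed (use frobenius[OF assms(1)] in
    \<open>auto intro: frobenius_lift_mem frobenius_lift_add frobenius_lift_mult\<close>)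

text \<open>On a ball of radius \<open>\<pi> ^ k\<close> each derivation divides the variable part by \<open>\<pi>\<close> and, modulo
  \<open>\<pi>\<close>, acts on it like a unit multiple of the Frobenius lift.\<close>

lemma \<delta>w_ball:
  assumes "\<mu> \<in> lists {1..n}" "length \<mu> \<le> k" "a \<in> A"
  shows "\<exists>c\<in>A. \<exists>c'\<in>A. c * c' = 1 \<and> (\<exists>Q \<in> poly_funs (words n (length \<mu>)) \<phi>w. \<forall>u\<in>A.
    \<delta>w \<mu> (a + \<pi> ^ k * u) = \<delta>w \<mu> a + \<pi> ^ (k - length \<mu>) * (c * \<phi>w \<mu> u + \<pi> * Q u))"
  using assms(1,2)
proof (induction \<mu> rule: list.induct)
  case Nil
  have "(\<lambda>_. 0) \<in> poly_funs (words n (length [])) \<phi>w" by (rule poly_funs.const[OF A_0])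
  then show ?case by (intro bexI[of _ 1] bexI[of _ "\<lambda>_. 0"] conjI) auto
next
  case (Cons i \<mu>)
  then have i: "i \<in> {1..n}" and \<mu>: "\<mu> \<in> lists {1..n}" by auto
  let ?s = "length \<mu>" and ?b = "\<delta>w \<mu> a" and ?p = "CARD('p)"
  define m where "m = k - length (i # \<mu>)"
  have km: "k - ?s = Suc m" using Cons.prems by (simp add: m_def)
  note \<phi>i = frobenius[OF i]
  obtain c c' Q where c: "c \<in> A" "c' \<in> A" "c * c' = 1" and Q: "Q \<in> poly_funs (words n ?s) \<phi>w"
    and IH: "\<And>u. u \<in> A \<Longrightarrow> \<delta>w \<mu> (a + \<pi> ^ k * u) = ?b + \<pi> ^ Suc m * (c * \<phi>w \<mu> u + \<pi> * Q u)"
    using Cons.IH[OF \<mu>] Cons.prems(2) unfolding km by auto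
  obtain \<eta> \<eta>' where \<eta>: "\<eta> \<in> A" "\<eta>' \<in> A" "\<eta> * \<eta>' = 1" "\<phi> i \<pi> = \<pi> * \<eta>"
    by (rule frobenius_lift_pi[OF \<phi>i])
  define w where "w u = c * \<phi>w \<mu> u + \<pi> * Q u" for u
  have \<mu>_poly: "\<phi>w \<mu> \<in> poly_funs (words n ?s) \<phi>w"
    by (rule poly_funs.coord) (use \<mu> in \<open>simp add: words_def\<close>)
  have w: "w \<in> poly_funs (words n ?s) \<phi>w"
    unfolding w_def[abs_def] by (intro poly_funs.add poly_funs_scale c A_pi Q \<mu>_poly)
  have w': "w \<in> poly_funs (words n (Suc ?s)) \<phi>w"
    using w poly_funs_words_mono[of ?s "Suc ?s"] by auto
  obtain R where R: "R \<in> poly_funs (words n (Suc ?s)) \<phi>w"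
    "\<And>u. (?b + \<pi> ^ Suc m * w u) ^ ?p = ?b ^ ?p + \<pi> ^ Suc (Suc m) * R u"
    using power_p_perturbation[OF \<delta>w_mem[OF \<mu> assms(3)] w'] by blast
  define d where "d = \<eta> ^ Suc m * \<phi> i c"
  define d' where "d' = \<eta>' ^ Suc m * \<phi> i c'"
  define S where "S u = (\<eta> ^ Suc m * \<eta>) * \<phi> i (Q u) - R u" for u
  have S: "S \<in> poly_funs (words n (Suc ?s)) \<phi>w"
    unfolding S_def[abs_def]
    by (intro poly_funs_diff poly_funs_scale A_mult A_power \<eta> \<phi>_poly_funs[OF i Q] R(1))
  have \<phi>c: "\<phi> i c \<in> A" "\<phi> i c' \<in> A" "\<phi> i c * \<phi> i c' = 1"
    using c frobenius_lift_mem[OF \<phi>i] frobenius_lift_mult[OF \<phi>i c(1,2)] frobenius_lift_1[OF \<phi>i]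
    by auto
  have "d * d' = (\<eta> * \<eta>') ^ Suc m * (\<phi> i c * \<phi> i c')"
    by (simp only: d_def d'_def power_mult_distrib mult_ac)
  then have dd': "d \<in> A" "d' \<in> A" "d * d' = 1"
    using \<eta> \<phi>c by (auto simp: d_def d'_def)
  have "\<delta>w (i # \<mu>) (a + \<pi> ^ k * u)
      = \<delta>w (i # \<mu>) a + \<pi> ^ m * (d * \<phi>w (i # \<mu>) u + \<pi> * S u)" if u: "u \<in> A" for u
  proof -
    have Qu: "Q u \<in> A" and \<mu>u: "\<phi>w \<mu> u \<in> A" and b: "?b \<in> A" and wu: "w u \<in> A"
      using poly_funs_mem[OF Q maps_A_\<phi>w u] \<phi>w_mem[OF \<mu> u] \<delta>w_mem[OF \<mu> assms(3)]
        poly_funs_mem[OF w maps_A_\<phi>w u] by auto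
    have \<phi>w_u: "\<phi> i (w u) = \<phi> i c * \<phi>w (i # \<mu>) u + \<pi> * \<eta> * \<phi> i (Q u)"
      using Qu \<mu>u c(1) by (simp add: w_def frobenius_lift_add[OF \<phi>i] frobenius_lift_mult[OF \<phi>i] \<eta>(4))
    have "\<phi> i (?b + \<pi> ^ Suc m * w u) = \<phi> i ?b + (\<pi> * \<eta>) ^ Suc m * \<phi> i (w u)"
      using b wu by (simp only: frobenius_lift_add[OF \<phi>i] frobenius_lift_mult[OF \<phi>i]
          frobenius_lift_power[OF \<phi>i] A_mult A_power A_pi \<eta>(4))
    then have "\<pi> * \<delta>w (i # \<mu>) (a + \<pi> ^ k * u)
        = \<phi> i ?b + (\<pi> * \<eta>) ^ Suc m * \<phi> i (w u) - (?b ^ ?p + \<pi> ^ Suc (Suc m) * R u)"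
      using IH[OF u] pi_nonzero R(2)[of u] by (simp add: pi_derivation_def w_def)
    also have "\<dots> = \<pi> * (\<delta>w (i # \<mu>) a + \<pi> ^ m * (d * \<phi>w (i # \<mu>) u + \<pi> * S u))"
      using pi_nonzero unfolding \<phi>w_u d_def S_def power_mult_distrib
      by (simp add: pi_derivation_def algebra_simps)
    finally show ?thesis using pi_nonzero by simp
  qed
  then have eq: "\<forall>u\<in>A. \<delta>w (i # \<mu>) (a + \<pi> ^ k * u)
      = \<delta>w (i # \<mu>) a + \<pi> ^ (k - length (i # \<mu>)) * (d * \<phi>w (i # \<mu>) u + \<pi> * S u)"
    unfolding m_def by blast
  have "S \<in> poly_funs (words n (length (i # \<mu>))) \<phi>w" using S by simp
  then show ?case
    by (intro bexI[OF _ dd'(1)] bexI[OF _ dd'(2)] conjI dd'(3) bexI[of _ S] eq)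
qed

lemma \<delta>w_ball_poly:
  assumes "\<mu> \<in> words n r" "a \<in> A"
  shows "(\<lambda>u. \<delta>w \<mu> (a + \<pi> ^ r * u)) \<in> poly_funs (words n r) \<phi>w"
proof -
  have \<mu>: "\<mu> \<in> lists {1..n}" "length \<mu> \<le> r" using assms(1) by (auto simp: words_def)
  obtain c Q where c: "c \<in> A" and Q: "Q \<in> poly_funs (words n (length \<mu>)) \<phi>w"
    and eq: "\<And>u. u \<in> A \<Longrightarrow> \<delta>w \<mu> (a + \<pi> ^ r * u)
      = \<delta>w \<mu> a + \<pi> ^ (r - length \<mu>) * (c * \<phi>w \<mu> u + \<pi> * Q u)"
    using \<delta>w_ball[OF \<mu> assms(2)] by blast
  have Q': "Q \<in> poly_funs (words n r) \<phi>w"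
    using poly_funs_words_mono[OF \<mu>(2)] Q by (rule subsetD)
  have "(\<lambda>u. \<delta>w \<mu> a + \<pi> ^ (r - length \<mu>) * (c * \<phi>w \<mu> u + \<pi> * Q u)) \<in> poly_funs (words n r) \<phi>w"
    by (intro poly_funs.add poly_funs_scale poly_funs.const[OF \<delta>w_mem[OF \<mu>(1) assms(2)]]
        poly_funs.coord assms(1) c Q' A_power A_pi)
  then show ?thesis using eq by (rule poly_funs.eq_on)
qed

text \<open>An arithmetic differential operator of order \<open>r\<close> is analytic on balls of radius \<open>\<pi> ^ r\<close>: there
  the variables \<open>\<delta>w \<mu>\<close> are polynomials in the \<open>\<phi>w \<nu>\<close> of the radial variable.\<close>

lemma series_funs_\<delta>w_ball:
  assumes "f \<in> series_funs (words n r) \<delta>w" "a \<in> A"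
  shows "(\<lambda>u. f (a + \<pi> ^ r * u)) \<in> series_funs (words n r) \<phi>w"
proof -
  have "poly_funs (words n r) (\<lambda>\<mu> u. \<delta>w \<mu> (a + \<pi> ^ r * u)) \<subseteq> poly_funs (words n r) \<phi>w"
    using \<delta>w_ball_poly[OF _ assms(2)] by (rule poly_funs_subset)
  moreover have "(\<lambda>u. f (a + \<pi> ^ r * u)) \<in> series_funs (words n r) (\<lambda>\<mu> u. \<delta>w \<mu> (a + \<pi> ^ r * u))"
    by (rule series_funs_comp[OF assms(1)]) (use assms(2) in auto)
  ultimately show ?thesis using series_funs_mono by blast
qed

context
  assumes n_pos: "1 \<le> n" and \<phi>1: "\<And>a. a \<in> A \<Longrightarrow> \<phi> 1 a = a"
begin

lemma \<phi>w_replicate_1: "b \<in> A \<Longrightarrow> \<phi>w (replicate k 1) b = b"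
  by (induction k) (simp_all add: \<phi>1[simplified])

text \<open>A word may be lengthened by letters \<open>1\<close> without changing \<open>\<phi>w\<close>, so only words of the maximal
  length \<open>r\<close> matter. For those the operators \<open>\<delta>w\<close> are, on a ball of radius \<open>\<pi> ^ r\<close>, affine images
  of \<open>\<phi>w\<close> modulo \<open>\<pi>\<close>.\<close>

lemma series_funs_\<phi>w_ball:
  assumes "f \<in> series_funs (words n r) \<phi>w" "a \<in> A"
  shows "\<exists>h \<in> series_funs (words n r) \<delta>w. \<forall>u\<in>A. \<forall>N. pi_cong \<pi> N (h (a + \<pi> ^ r * u)) (f u)"
proof -
  let ?z = "\<lambda>\<mu> u. \<delta>w \<mu> (a + \<pi> ^ r * u)"
  have z: "?z \<mu> \<in> poly_funs (words n r) \<phi>w" if "\<mu> \<in> words n r" for \<mu>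
    using that assms(2) by (rule \<delta>w_ball_poly)
  have "\<exists>f \<in> poly_funs (words n r) ?z. \<exists>g \<in> poly_funs (words n r) \<phi>w. \<forall>u\<in>A. \<phi>w \<mu> u = f u + \<pi> * g u"
    if \<mu>: "\<mu> \<in> words n r" for \<mu>
  proof -
    define \<nu> where "\<nu> = replicate (r - length \<mu>) 1 @ \<mu>"
    have \<nu>: "\<nu> \<in> lists {1..n}" "length \<nu> = r"
      using \<mu> n_pos by (auto simp: \<nu>_def words_def)
    then have \<nu>W: "\<nu> \<in> words n r" by (simp add: words_def)
    obtain c c' Q where c: "c \<in> A" "c' \<in> A" "c * c' = 1" and Q: "Q \<in> poly_funs (words n r) \<phi>w"
      and eq: "\<And>u. u \<in> A \<Longrightarrow> ?z \<nu> u = \<delta>w \<nu> a + (c * \<phi>w \<nu> u + \<pi> * Q u)"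
      using \<delta>w_ball[of \<nu> r a] \<nu> assms(2) by auto
    have "\<phi>w \<mu> u = c' * (?z \<nu> u - \<delta>w \<nu> a) + \<pi> * ((- c') * Q u)" if u: "u \<in> A" for u
    proof -
      have "\<phi>w \<nu> u = \<phi>w \<mu> u"
        using \<mu> u by (simp add: \<nu>_def word_comp_append words_def \<phi>w_replicate_1 \<phi>w_mem del: One_nat_def)
      then have "c' * (?z \<nu> u - \<delta>w \<nu> a) = (c * c') * \<phi>w \<mu> u + \<pi> * (c' * Q u)"
        unfolding eq[OF u] by (simp add: algebra_simps)
      then show ?thesis using c(3) by simp
    qed
    moreover have "(\<lambda>u. c' * (?z \<nu> u - \<delta>w \<nu> a)) \<in> poly_funs (words n r) ?z"
      by (intro poly_funs_scale poly_funs_diff c poly_funs.coord[of \<nu> _ ?z] \<nu>W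
          poly_funs.const \<delta>w_mem \<nu> assms(2))
    moreover have "(\<lambda>u. (- c') * Q u) \<in> poly_funs (words n r) \<phi>w"
      by (intro poly_funs_scale A_uminus c Q)
    ultimately show ?thesis
      by (intro bexI[of _ "\<lambda>u. c' * (?z \<nu> u - \<delta>w \<nu> a)"] bexI[of _ "\<lambda>u. (- c') * Q u"] ballI)
  qed
  note yz = this
  have "series_funs (words n r) \<phi>w \<subseteq> series_funs (words n r) ?z"
  proof (rule series_funs_change_of_coordinates[OF maps_A_\<phi>w])
    show "?z \<mu> \<in> poly_funs (words n r) \<phi>w" if "\<mu> \<in> words n r" for \<mu>
      using that by (rule z)
  qed (rule yz)
  then have "f \<in> series_funs (words n r) ?z" using assms(1) by (rule subsetD)
  then show ?thesis
    by (rule series_funs_comp_lift[OF _ maps_A_\<delta>w]) (use assms(2) in auto)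
qed

text \<open>A ball of radius \<open>\<pi> ^ k\<close> splits into \<open>p\<close> balls of radius \<open>\<pi> ^ (k + 1)\<close>. The \<open>k\<close>-fold iterate \<open>D\<close> of
  \<open>\<delta>\<^sub>1\<close> is affine modulo \<open>\<pi>\<close> on the large ball, so its residue tells the small balls apart, and
  \<open>D - D ^ p = \<pi> D'\<close>, where \<open>D'\<close> is the next iterate, makes the indicator of each residue class a
  series in the operators of order at most \<open>k + 1\<close>. The local series are multiplied by these
  indicators and added.\<close>

lemma glue_residue_classes:
  assumes k: "Suc k \<le> r"
    and f: "\<And>v. v \<in> A \<Longrightarrow> f v \<in> A"
    and loc: "\<And>a. a \<in> A \<Longrightarrow> \<exists>h \<in> series_funs (words n r) \<delta>w.
      \<forall>u\<in>A. \<forall>N. pi_cong \<pi> N (h (a + \<pi> ^ Suc k * u)) (f (a + \<pi> ^ Suc k * u))"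
    and a: "a \<in> A"
  shows "\<exists>h \<in> series_funs (words n r) \<delta>w. \<forall>u\<in>A. \<forall>N. pi_cong \<pi> N (h (a + \<pi> ^ k * u)) (f (a + \<pi> ^ k * u))"
proof -
  let ?W = "words n r" and ?p = "CARD('p)"
  have \<phi>_1: "frobenius_lift \<pi> (\<phi> 1)" by (rule frobenius) (use n_pos in auto)
  define D where "D = \<delta>w (replicate k 1)"
  define D' where "D' = \<delta>w (replicate (Suc k) 1)"
  have ones: "replicate j 1 \<in> lists {1..n}" for j using n_pos by auto
  have W1: "replicate k 1 \<in> ?W" and W2: "replicate (Suc k) 1 \<in> ?W"
    using ones[of k] ones[of "Suc k"] k by (simp_all add: words_def del: One_nat_def replicate_Suc)
  have D: "D \<in> poly_funs ?W \<delta>w" unfolding D_def using W1 by (rule poly_funs.coord)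
  have D': "D' \<in> poly_funs ?W \<delta>w" unfolding D'_def using W2 by (rule poly_funs.coord)
  note D_mem = poly_funs_mem[OF D maps_A_\<delta>w]
  have DD': "D v = D v ^ ?p + \<pi> * D' v" if "v \<in> A" for v
    using frobenius_lift_eq[OF \<phi>_1, of "D v"] \<phi>1[OF D_mem[OF that]] by (simp add: D_def D'_def)
  obtain c c' Q where c: "c \<in> A" "c' \<in> A" "c * c' = 1" and Q: "Q \<in> poly_funs (words n k) \<phi>w"
    and ball: "\<And>u. u \<in> A \<Longrightarrow> D (a + \<pi> ^ k * u) = D a + (c * u + \<pi> * Q u)"
    using \<delta>w_ball[OF ones[of k] _ a, of k] \<phi>w_replicate_1 unfolding D_def by auto
  \<comment> \<open>The centres of the small balls.\<close>
  define b where "b j = a + \<pi> ^ k * of_nat j" for j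
  have b: "b j \<in> A" for j using a by (auto simp: b_def)
  define x where "x j v = - D (b j) + D v" for j v
  have "\<exists>\<chi> \<in> series_funs ?W \<delta>w. \<forall>v\<in>A.
    (pi_cong \<pi> 1 (x j v) 0 \<longrightarrow> (\<forall>N. pi_cong \<pi> N (\<chi> v) 1)) \<and>
    ((\<exists>b\<in>A. pi_cong \<pi> 1 (x j v * b) 1) \<longrightarrow> (\<forall>N. pi_cong \<pi> N (\<chi> v) 0))" for j
  proof -
    define t where "t = - D (b j)"
    have t: "t \<in> A" using D_mem[OF b] by (simp add: t_def)
    have t_eq: "t = t ^ ?p + \<pi> * pi_derivation \<pi> (\<phi> 1) t"
      using frobenius_lift_eq[OF \<phi>_1, of t] \<phi>1[OF t] by simp
    obtain d where d: "\<forall>i. d i \<in> A"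
      "\<forall>w. (t + w) ^ ?p = t ^ ?p + w ^ ?p + \<pi> * (\<Sum>i\<in>{1..<?p}. d i * w ^ i)"
      using power_p_binomial[OF t] by blast
    have x: "(\<lambda>v. t + D v) \<in> poly_funs ?W \<delta>w"
      by (intro poly_funs.add poly_funs.const t D)
    have g: "(\<lambda>v. (pi_derivation \<pi> (\<phi> 1) t + D' v) - (\<Sum>i\<in>{1..<?p}. d i * D v ^ i)) \<in> poly_funs ?W \<delta>w"
      by (intro poly_funs_diff poly_funs.add poly_funs.const pi_derivation_mem[OF \<phi>_1] t D'
          poly_funs_sum poly_funs_scale poly_funs_power D spec[OF d(1)])
    have "(t + D v) - (t + D v) ^ ?p
        = \<pi> * ((pi_derivation \<pi> (\<phi> 1) t + D' v) - (\<Sum>i\<in>{1..<?p}. d i * D v ^ i))" if "v \<in> A" for v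
    proof -
      have "(t + D v) - (t + D v) ^ ?p
          = (t - t ^ ?p) + (D v - D v ^ ?p) - \<pi> * (\<Sum>i\<in>{1..<?p}. d i * D v ^ i)"
        unfolding spec[OF d(2)] by (simp only: algebra_simps)
      also have "t - t ^ ?p = \<pi> * pi_derivation \<pi> (\<phi> 1) t" using t_eq by (simp only: diff_eq_eq add.commute)
      also have "D v - D v ^ ?p = \<pi> * D' v" using DD'[OF that] by (simp only: diff_eq_eq add.commute)
      finally show ?thesis by (simp only: distrib_left right_diff_distrib)
    qed
    then show ?thesis
      unfolding x_def t_def[symmetric] by (rule residue_indicator[OF maps_A_\<delta>w x g])
  qed
  then obtain \<chi> where \<chi>: "\<And>j. \<chi> j \<in> series_funs ?W \<delta>w"
    "\<And>j v N. v \<in> A \<Longrightarrow> pi_cong \<pi> 1 (x j v) 0 \<Longrightarrow> pi_cong \<pi> N (\<chi> j v) 1"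
    "\<And>j v N b. v \<in> A \<Longrightarrow> b \<in> A \<Longrightarrow> pi_cong \<pi> 1 (x j v * b) 1 \<Longrightarrow> pi_cong \<pi> N (\<chi> j v) 0"
    by metis
  obtain h where h: "\<And>j. h j \<in> series_funs ?W \<delta>w"
    "\<And>j u N. u \<in> A \<Longrightarrow> pi_cong \<pi> N (h j (b j + \<pi> ^ Suc k * u)) (f (b j + \<pi> ^ Suc k * u))"
    using loc[OF b] by metis
  have "pi_cong \<pi> N (\<Sum>j<?p. \<chi> j v * h j v) (f v)" if u: "u \<in> A" and v: "v = a + \<pi> ^ k * u" for u v N
  proof -
    have vA: "v \<in> A" using a u by (auto simp: v)
    obtain j0 where j0: "j0 < ?p" "pi_cong \<pi> 1 u (of_nat j0)" using u by (rule A_residue)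
    obtain u' where u': "u' \<in> A" "u = of_nat j0 + \<pi> ^ 1 * u'" using j0(2) by (rule pi_congE)
    have v': "v = b j0 + \<pi> ^ Suc k * u'" by (simp add: v u'(2) b_def algebra_simps)
    have xj: "pi_cong \<pi> 1 (x j v) (c * of_int (int j0 - int j))" for j
    proof -
      have "Q (of_nat j) \<in> A" "Q u \<in> A"
        using poly_funs_mem[OF Q maps_A_\<phi>w] u by auto
      moreover have "x j v = c * (u - of_nat j) + \<pi> * (Q u - Q (of_nat j))"
        using ball[OF u] ball[OF A_of_nat[of j]] by (simp add: x_def v b_def algebra_simps)
      ultimately show ?thesis
        using u' c(1) by (intro pi_congI[of "c * u' + (Q u - Q (of_nat j))"]) (auto simp: algebra_simps)
    qed
    have "pi_cong \<pi> N (\<Sum>j<?p. \<chi> j v * h j v) (\<Sum>j<?p. if j = j0 then f v else 0)"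
    proof (rule pi_cong_sum)
      fix j assume j: "j \<in> {..<?p}"
      show "pi_cong \<pi> N (\<chi> j v * h j v) (if j = j0 then f v else 0)"
      proof (cases "j = j0")
        case True
        then have "pi_cong \<pi> 1 (x j v) 0" using xj[of j] by simp
        then have "pi_cong \<pi> N (\<chi> j v * h j v) (1 * f v)"
          using h(2)[OF u'(1), of N j0] vA True
          by (intro pi_cong_mult \<chi>(2) series_funs_mem[OF \<chi>(1)] f) (simp_all add: v')
        then show ?thesis using True by simp
      next
        case False
        have "\<not> int ?p dvd int j0 - int j"
        proof
          assume "int ?p dvd int j0 - int j"
          then have "int ?p \<le> \<bar>int j0 - int j\<bar>" using False by (intro zdvd_imp_le) (auto simp: dvd_abs_iff)
          then show False using j j0(1) by auto
        qed
        then obtain l where l: "pi_cong \<pi> 1 (of_int (int j0 - int j) * of_int l) 1" by (rule int_unit_mod_pi)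
        have "pi_cong \<pi> 1 (x j v * (c' * of_int l)) (c * of_int (int j0 - int j) * (c' * of_int l))"
          using c(2) by (intro pi_cong_mult_right xj) auto
        also have "c * of_int (int j0 - int j) * (c' * of_int l)
            = (c * c') * (of_int (int j0 - int j) * of_int l)" by (simp only: mult_ac)
        also have "\<dots> = of_int (int j0 - int j) * of_int l" using c(3) by simp
        also note l
        finally have "pi_cong \<pi> N (\<chi> j v) 0"
          using c(2) by (intro \<chi>(3)[OF vA, of "c' * of_int l"]) auto
        then have "pi_cong \<pi> N (\<chi> j v * h j v) (0 * h j v)"
          by (rule pi_cong_mult_right) (rule series_funs_mem[OF h(1) vA])
        then show ?thesis using False by simp
      qed
    qed
    then show ?thesis using j0(1) by simp
  qed
  moreover have "(\<lambda>v. \<Sum>j<?p. \<chi> j v * h j v) \<in> series_funs ?W \<delta>w"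
    by (intro series_funs_sum series_funs_mult maps_A_\<delta>w \<chi>(1) h(1))
  ultimately show ?thesis by (intro bexI[of _ "\<lambda>v. \<Sum>j<?p. \<chi> j v * h j v"]) auto
qed

lemma series_funs_of_locally:
  assumes f: "\<And>v. v \<in> A \<Longrightarrow> f v \<in> A"
    and loc: "\<And>a. a \<in> A \<Longrightarrow> \<exists>h \<in> series_funs (words n r) \<delta>w.
      \<forall>u\<in>A. \<forall>N. pi_cong \<pi> N (h (a + \<pi> ^ r * u)) (f (a + \<pi> ^ r * u))"
  shows "f \<in> series_funs (words n r) \<delta>w"
proof -
  have step: "\<forall>a\<in>A. \<exists>h \<in> series_funs (words n r) \<delta>w.
      \<forall>u\<in>A. \<forall>N. pi_cong \<pi> N (h (a + \<pi> ^ (r - i) * u)) (f (a + \<pi> ^ (r - i) * u))" if "i \<le> r" for i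
    using that
  proof (induction i)
    case 0
    then show ?case using loc by simp
  next
    case (Suc i)
    then have i: "r - i = Suc (r - Suc i)" by simp
    then have le: "Suc (r - Suc i) \<le> r" by linarith
    note IH = Suc.IH[OF Suc_leD[OF Suc.prems], unfolded i]
    show ?case
      by (rule ballI, rule glue_residue_classes[OF le f bspec[OF IH]])
  qed
  from bspec[OF step[OF le_refl] A_0] obtain h where h: "h \<in> series_funs (words n r) \<delta>w"
    "\<forall>u\<in>A. \<forall>N. pi_cong \<pi> N (h u) (f u)"
    by auto
  show ?thesis
  proof (rule series_funs_cong[OF h(1)])
    fix u N assume "u \<in> A"
    then have "pi_cong \<pi> N (h u) (f u)" using h(2) by blast
    then show "pi_cong \<pi> N (f u) (h u)" by (rule pi_cong_sym)
  qed
qed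

end

lemma arithmetic_pdo_iff: "arithmetic_pdo \<pi> n \<phi> r f \<longleftrightarrow> f \<in> series_funs (words n r) \<delta>w"
proof
  assume "arithmetic_pdo \<pi> n \<phi> r f"
  then obtain G where G: "G \<in> restricted_power_series \<pi> (words n r)"
    "\<forall>v\<in>A. has_value \<pi> (words n r) G (\<lambda>\<mu>. \<delta>w \<mu> v) (f v)"
    unfolding arithmetic_pdo_def by (rule bexE)
  show "f \<in> series_funs (words n r) \<delta>w"
    by (rule has_value_series_funs[OF G(1) maps_A_\<delta>w]) (rule bspec[OF G(2)])
next
  assume "f \<in> series_funs (words n r) \<delta>w"
  from series_funs_has_value[OF this maps_A_\<delta>w finite_words]
  show "arithmetic_pdo \<pi> n \<phi> r f" unfolding arithmetic_pdo_def .
qed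

lemma analytic_of_level_iff:
  "analytic_of_level \<pi> n \<phi> r f \<longleftrightarrow>
    (\<forall>a\<in>A. (\<lambda>u. f (a + \<pi> ^ r * u)) \<in> series_funs (words n r) \<phi>w)"
  unfolding analytic_of_level_def
proof (rule ball_cong[OF refl], rule iffI)
  fix a
  assume "\<exists>G\<in>restricted_power_series \<pi> (words n r). \<forall>u\<in>A.
    has_value \<pi> (words n r) G (\<lambda>\<mu>. \<phi>w \<mu> u) (f (a + \<pi> ^ r * u))"
  then obtain G where G: "G \<in> restricted_power_series \<pi> (words n r)"
    "\<forall>u\<in>A. has_value \<pi> (words n r) G (\<lambda>\<mu>. \<phi>w \<mu> u) (f (a + \<pi> ^ r * u))"
    by (rule bexE)
  show "(\<lambda>u. f (a + \<pi> ^ r * u)) \<in> series_funs (words n r) \<phi>w"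
    by (rule has_value_series_funs[OF G(1) maps_A_\<phi>w]) (rule bspec[OF G(2)])
next
  fix a
  assume "(\<lambda>u. f (a + \<pi> ^ r * u)) \<in> series_funs (words n r) \<phi>w"
  from series_funs_has_value[OF this maps_A_\<phi>w finite_words]
  show "\<exists>G\<in>restricted_power_series \<pi> (words n r). \<forall>u\<in>A.
    has_value \<pi> (words n r) G (\<lambda>\<mu>. \<phi>w \<mu> u) (f (a + \<pi> ^ r * u))" .
qed

lemma arithmetic_pdo_imp_analytic:
  assumes "arithmetic_pdo \<pi> n \<phi> r f" shows "analytic_of_level \<pi> n \<phi> r f"
  unfolding analytic_of_level_iff
  using assms[unfolded arithmetic_pdo_iff] by (intro ballI series_funs_\<delta>w_ball)

lemma analytic_imp_arithmetic_pdo: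
  assumes "1 \<le> n" "\<And>a. a \<in> A \<Longrightarrow> \<phi> 1 a = a" "\<And>v. v \<in> A \<Longrightarrow> f v \<in> A" "analytic_of_level \<pi> n \<phi> r f"
  shows "arithmetic_pdo \<pi> n \<phi> r f"
  unfolding arithmetic_pdo_iff
proof (rule series_funs_of_locally[OF assms(1-3)])
  fix a assume a: "a \<in> A"
  then have "(\<lambda>u. f (a + \<pi> ^ r * u)) \<in> series_funs (words n r) \<phi>w"
    using assms(4)[unfolded analytic_of_level_iff] by (rule bspec[rotated])
  then show "\<exists>h \<in> series_funs (words n r) \<delta>w.
      \<forall>u\<in>A. \<forall>N. pi_cong \<pi> N (h (a + \<pi> ^ r * u)) (f (a + \<pi> ^ r * u))"
    using a by (intro series_funs_\<phi>w_ball assms(1,2))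
qed

end

theorem theorem1p2:
  fixes \<pi> :: "'p::prime_card Qp_closure"
    and \<phi> :: "nat \<Rightarrow> 'p Qp_closure \<Rightarrow> 'p Qp_closure"
    and n r :: nat
  assumes "admissible_uniformizer \<pi>"
    and "\<forall>i \<in> {1..n}. frobenius_lift \<pi> (\<phi> i)"
  shows "(\<forall>f \<in> Zp_adjoin \<pi> \<rightarrow> Zp_adjoin \<pi>.
            arithmetic_pdo \<pi> n \<phi> r f \<longrightarrow> analytic_of_level \<pi> n \<phi> r f) \<and>
         (n \<ge> 1 \<and> (\<forall>a \<in> Zp_adjoin \<pi>. \<phi> 1 a = a) \<longrightarrow>
            (\<forall>f \<in> Zp_adjoin \<pi> \<rightarrow> Zp_adjoin \<pi>.
               analytic_of_level \<pi> n \<phi> r f \<longrightarrow> arithmetic_pdo \<pi> n \<phi> r f))"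
proof -
  obtain E :: "'p padic_int poly"
    where "eisenstein E" "Polynomial.poly (map_poly of_padic_int E) \<pi> = 0"
    using assms(1) by (auto simp: admissible_uniformizer_def)
  then interpret frobenius_family \<pi> E \<phi> n
    using assms(2) by unfold_locales auto
  show ?thesis
  proof (intro conjI ballI impI)
    fix f assume "arithmetic_pdo \<pi> n \<phi> r f"
    then show "analytic_of_level \<pi> n \<phi> r f" by (rule arithmetic_pdo_imp_analytic)
  next
    fix f assume "n \<ge> 1 \<and> (\<forall>a\<in>A. \<phi> 1 a = a)" "f \<in> A \<rightarrow> A" "analytic_of_level \<pi> n \<phi> r f"
    then show "arithmetic_pdo \<pi> n \<phi> r f" by (intro analytic_imp_arithmetic_pdo) auto
  qed
qed

end
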